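(* Let $m$ be a positive integer, let $S=R_y^{2\pi/4}$, $T=R_x^{2\pi/m}$, $U=R_x^{2\pi/4}$, and let $H=G(4,4,1)\cap G(m,4,1)$. Let $g$ be an arbitrary element of $G(m,4,1)$. Then $g$ can be uniquely written in the form $$g = W\,ST^{a_1}\cdots ST^{a_n}\,E,$$ for some $n\ge 0$, where $W$ and $E$ are elements of $H$, each $a_i$ is an integer, and the following restrictions are applied: 1. If $m$ is odd, $W\in\{\mathbb{I},S^3\}$, $a_i\in(-\frac m2,\frac m2)$, and $a_i\ne 0$. 2. If $m$ is twice an odd number, $W\in\{\mathbb{I},S^3\}$, $a_i\in(-\frac m4,\frac m4)$ and $a_i\neq 0$. 3. If $m$ is divisible by $4$, $W\in\{\mathbb{I},S^3,U\}$, $a_i\in(-\frac m4,\frac m4)$, $a_i\ne 0$, and $a_n\in(0,\frac m4)$. 4. If $n=0$, then $W=\mathbb{I}$.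
   Context: $R_x^{\theta}, R_y^{\theta}, R_z^{\theta}\in SO(3)$ denote the rotations of Euclidean 3-space by angle $\theta$ (right-hand rule) about the $x$-, $y$- and $z$-axis. For positive integers $p,\ell,q$, $G(p,\ell,q)$ is the subgroup of $SO(3)$ generated by $R_x^{2\pi/p}$, $R_y^{2\pi/\ell}$ and $R_z^{2\pi/q}$. Thus $G(m,4,1)$ is generated by $T$ and $S$, and $G(4,4,1)$ is generated by $U$ and $S$. $\mathbb{I}$ is the identity matrix. "Uniquely written" means that $n$, $W$, $a_1,\dots,a_n$ and $E$ are uniquely determined by $g$. For $n=0$ the expression is $WE$, and the conditions on the $a_i$ are vacuous. *)

theory Defs
  imports "HOL-Analysis.Analysis" "HOL-Algebra.Generated_Groups"
begin

definition SO3 :: "(real^3^3) monoid" where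
  "SO3 = \<lparr>carrier = {A. rotation_matrix A}, mult = (**), one = mat 1\<rparr>"

text \<open>Matrices are given by rows and act on column vectors, so the rotations below are
  counterclockwise as seen from the tip of the axis (right-hand rule).\<close>

definition Rx :: "real \<Rightarrow> real^3^3" where
  "Rx \<theta> = vector [vector [1, 0, 0],
                   vector [0, cos \<theta>, - sin \<theta>],
                   vector [0, sin \<theta>, cos \<theta>]]"

definition Ry :: "real \<Rightarrow> real^3^3" where
  "Ry \<theta> = vector [vector [cos \<theta>, 0, sin \<theta>],
                   vector [0, 1, 0],
                   vector [- sin \<theta>, 0, cos \<theta>]]"

definition Rz :: "real \<Rightarrow> real^3^3" where
  "Rz \<theta> = vector [vector [cos \<theta>, - sin \<theta>, 0],
                   vector [sin \<theta>, cos \<theta>, 0],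
                   vector [0, 0, 1]]"

definition G :: "nat \<Rightarrow> nat \<Rightarrow> nat \<Rightarrow> (real^3^3) set" where
  "G p l q = generate SO3 {Rx (2 * pi / real p), Ry (2 * pi / real l), Rz (2 * pi / real q)}"

definition S :: "real^3^3" where
  "S = Ry (2 * pi / 4)"

definition T :: "nat \<Rightarrow> real^3^3" where
  "T m = Rx (2 * pi / real m)"

definition U :: "real^3^3" where
  "U = Rx (2 * pi / 4)"

definition H :: "nat \<Rightarrow> (real^3^3) set" where
  "H m = G 4 4 1 \<inter> G m 4 1"

fun ST_word :: "nat \<Rightarrow> int list \<Rightarrow> real^3^3" where
  "ST_word m [] = \<one>\<^bsub>SO3\<^esub>"
| "ST_word m (a # as) = S \<otimes>\<^bsub>SO3\<^esub> (T m [^]\<^bsub>SO3\<^esub> a) \<otimes>\<^bsub>SO3\<^esub> ST_word m as"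

definition restrictions :: "nat \<Rightarrow> nat \<Rightarrow> real^3^3 \<Rightarrow> int list \<Rightarrow> bool" where
  "restrictions m n W as \<longleftrightarrow>
     (odd m \<longrightarrow>
        W \<in> {\<one>\<^bsub>SO3\<^esub>, S [^]\<^bsub>SO3\<^esub> (3::nat)} \<and>
        (\<forall>a\<in>set as. real_of_int a \<in> {- (real m / 2)<..<real m / 2} \<and> a \<noteq> 0)) \<and>
     ((\<exists>k. odd k \<and> m = 2 * k) \<longrightarrow>
        W \<in> {\<one>\<^bsub>SO3\<^esub>, S [^]\<^bsub>SO3\<^esub> (3::nat)} \<and>
        (\<forall>a\<in>set as. real_of_int a \<in> {- (real m / 4)<..<real m / 4} \<and> a \<noteq> 0)) \<and>
     (4 dvd m \<longrightarrow>
        W \<in> {\<one>\<^bsub>SO3\<^esub>, S [^]\<^bsub>SO3\<^esub> (3::nat), U} \<and>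
        (\<forall>a\<in>set as. real_of_int a \<in> {- (real m / 4)<..<real m / 4} \<and> a \<noteq> 0) \<and>
        (n > 0 \<longrightarrow> real_of_int (last as) \<in> {0<..<real m / 4})) \<and>
     (n = 0 \<longrightarrow> W = \<one>\<^bsub>SO3\<^esub>)"

lemma group_SO3: "group SO3"
proof (rule groupI)
  fix A assume "A \<in> carrier SO3"
  then have A: "orthogonal_matrix A" "det A = 1"
    by (auto simp: SO3_def rotation_matrix_def)
  show "\<exists>B\<in>carrier SO3. B \<otimes>\<^bsub>SO3\<^esub> A = \<one>\<^bsub>SO3\<^esub>"
    using A by (intro bexI[of _ "transpose A"])
      (auto simp: SO3_def rotation_matrix_def det_transpose orthogonal_matrix_transpose
        orthogonal_matrix_def)
qed (auto simp: SO3_def rotation_matrix_def orthogonal_matrix_mul det_mul det_I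
      orthogonal_matrix_id matrix_mul_assoc)

lemma R_in_SO3:
  "Rx \<theta> \<in> carrier SO3" "Ry \<theta> \<in> carrier SO3" "Rz \<theta> \<in> carrier SO3"
  by (auto simp: SO3_def rotation_matrix_def orthogonal_matrix Rx_def Ry_def Rz_def
      matrix_matrix_mult_def transpose_def mat_def vec_eq_iff forall_3 sum_3 vector_3 det_3
      power2_eq_square[symmetric] algebra_simps)

end

theory Submission
  imports Defs
begin

text \<open>Uniqueness is a 2-adic argument. By Zorn's lemma the complex numbers contain a valuation ring in
  which 2 is not a unit. Roots of unity lie in it, and a root of unity congruent to 1 modulo 2 is
  \<open>\<plusminus>1\<close>, so \<open>cos\<close> and \<open>sin\<close> of every angle \<open>2 \<pi> a / m\<close> with \<open>m\<close> not dividing \<open>4 a\<close> are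
  non-integral and of equal valuation. Measure a row of a matrix by the module spanned by its entries,
  which does not change when multiplying by an integral orthogonal matrix on the right. Each
  admissible factor \<open>S T\<^sup>a\<close> enlarges the first two rows equally and leaves the third strictly
  smaller. The position of the small row hence reveals \<open>W\<close>; after cancelling \<open>W\<close> and \<open>S\<close>, a
  wrong first exponent would make the rows 2 and 3 equally large, or, if it is off by \<open>m / 4\<close>, exchange
  them; the latter is only harmless in the last position, where \<open>a\<^sub>n > 0\<close> forbids it.

  Existence is a rewriting argument: half turns about the axes move through a word to the right
  at the cost of changing signs of exponents, and \<open>S U S = U S U\<close>; so the elements with a normal form
  (up to the sign of \<open>a\<^sub>n\<close>, which is repaired by \<open>U\<close>) are closed under left multiplication by the generators.\<close>

subsection \<open>Valuation rings\<close>

definition unital_subring :: "'a::comm_ring_1 set \<Rightarrow> bool" where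
  "unital_subring B \<longleftrightarrow> 1 \<in> B \<and> (\<forall>x\<in>B. \<forall>y\<in>B. x - y \<in> B \<and> x * y \<in> B)"

context
  fixes B :: "'a::comm_ring_1 set"
  assumes B: "unital_subring B"
begin

lemma subring_1: "1 \<in> B"
  and subring_diff: "x \<in> B \<Longrightarrow> y \<in> B \<Longrightarrow> x - y \<in> B"
  and subring_mult: "x \<in> B \<Longrightarrow> y \<in> B \<Longrightarrow> x * y \<in> B"
  using B by (auto simp: unital_subring_def)

lemma subring_0: "0 \<in> B"
  using subring_diff[OF subring_1 subring_1] by simp

lemma subring_minus: "x \<in> B \<Longrightarrow> - x \<in> B"
  using subring_diff[OF subring_0] by simp

lemma subring_add: "x \<in> B \<Longrightarrow> y \<in> B \<Longrightarrow> x + y \<in> B"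
  using subring_diff[OF _ subring_minus] by fastforce

lemma subring_sum: "(\<And>i. i \<in> A \<Longrightarrow> f i \<in> B) \<Longrightarrow> sum f A \<in> B"
  by (induction A rule: infinite_finite_induct) (auto simp: subring_0 subring_add)

lemma subring_power: "x \<in> B \<Longrightarrow> x ^ n \<in> B"
  by (induction n) (auto simp: subring_1 subring_mult)

lemma subring_of_nat: "of_nat n \<in> B"
  by (induction n) (auto simp: subring_0 subring_1 subring_add)

lemma subring_of_int: "of_int k \<in> B"
  using subring_of_nat subring_minus by (cases k) (auto simp del: of_nat_Suc)

end

section \<open>Adjoining one element to a subring\<close>

definition poly_values :: "'a::comm_ring_1 set \<Rightarrow> nat \<Rightarrow> 'a \<Rightarrow> 'a set" where
  "poly_values B n x = {poly p x |p. degree p \<le> n \<and> (\<forall>i. coeff p i \<in> B)}"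

lemma poly_values_add:
  assumes "unital_subring B" "u \<in> poly_values B n x" "v \<in> poly_values B n x"
  shows "u + v \<in> poly_values B n x"
proof -
  obtain p q where "degree p \<le> n" "\<forall>i. coeff p i \<in> B" "degree q \<le> n" "\<forall>i. coeff q i \<in> B"
    "u = poly p x" "v = poly q x"
    using assms by (auto simp: poly_values_def)
  then show ?thesis
    unfolding poly_values_def using assms(1)
    by (intro CollectI exI[of _ "p + q"]) (auto intro: degree_add_le subring_add)
qed

lemma poly_values_monom:
  assumes "unital_subring B" "b \<in> B" "i \<le> n"
  shows "b * x ^ i \<in> poly_values B n x"
  unfolding poly_values_def using assms
  by (intro CollectI exI[of _ "monom b i"])
    (auto simp: poly_monom subring_0 intro: order_trans[OF degree_monom_le])

lemma poly_values_sum: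
  assumes "unital_subring B" "\<And>i. i \<in> A \<Longrightarrow> f i \<in> poly_values B n x"
  shows "sum f A \<in> poly_values B n x"
  using assms(2)
proof (induction A rule: infinite_finite_induct)
  case (infinite A)
  then show ?case using poly_values_monom[OF assms(1) subring_0[OF assms(1)], of 0 n x] by simp
next
  case empty
  then show ?case using poly_values_monom[OF assms(1) subring_0[OF assms(1)], of 0 n x] by simp
qed (auto intro: poly_values_add[OF assms(1)])

lemma poly_values_eq:
  assumes "u \<in> poly_values B n x"
  obtains f where "\<And>i. f i \<in> B" "u = (\<Sum>i\<le>n. f i * x ^ i)"
proof -
  obtain p where p: "degree p \<le> n" "\<forall>i. coeff p i \<in> B" "u = poly p x"
    using assms by (auto simp: poly_values_def)
  have "poly p x = (\<Sum>i\<le>n. coeff p i * x ^ i)"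
    unfolding poly_altdef using p(1) by (intro sum.mono_neutral_left) (auto intro: le_degree)
  then show ?thesis using p that[of "coeff p"] by auto
qed

lemma subring_adjoin:
  assumes "unital_subring B"
  shows "unital_subring (\<Union>n. poly_values B n x)"
proof -
  have eq: "(\<Union>n. poly_values B n x) = {poly p x |p. \<forall>i. coeff p i \<in> B}"
    by (auto simp: poly_values_def)
  show ?thesis
    unfolding unital_subring_def eq
  proof (intro conjI ballI)
    show "1 \<in> {poly p x |p. \<forall>i. coeff p i \<in> B}"
      using assms by (intro CollectI exI[of _ 1]) (auto simp: subring_0 subring_1)
  next
    fix u v assume "u \<in> {poly p x |p. \<forall>i. coeff p i \<in> B}" "v \<in> {poly p x |p. \<forall>i. coeff p i \<in> B}"
    then obtain p q where *: "\<forall>i. coeff p i \<in> B" "\<forall>i. coeff q i \<in> B" "u = poly p x" "v = poly q x"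
      by blast
    show "u - v \<in> {poly p x |p. \<forall>i. coeff p i \<in> B}"
      using * assms by (intro CollectI exI[of _ "p - q"]) (auto simp: subring_diff)
    show "u * v \<in> {poly p x |p. \<forall>i. coeff p i \<in> B}"
      using * assms by (intro CollectI exI[of _ "p * q"])
        (auto simp: coeff_mult intro!: subring_sum subring_mult)
  qed
qed

text \<open>As \<open>1 - p h\<^sub>0\<close> is a unit, the relation for \<open>1 / x\<close> rewrites the top term \<open>f\<^sub>n x\<^sup>n\<close> of the relation
  for \<open>x\<close> by lower powers of \<open>x\<close>.\<close>

lemma poly_values_degree_descent:
  fixes x :: "'a::field"
  assumes B: "unital_subring B" and x: "x \<noteq> 0"
    and unit: "\<And>c. c \<in> B \<Longrightarrow> inverse (1 + p * c) \<in> B" "\<And>c. c \<in> B \<Longrightarrow> 1 + p * c \<noteq> 0"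
    and p: "p \<in> B" "p \<noteq> 0"
    and n: "inverse p \<in> poly_values B (Suc n) x"
    and k: "inverse p \<in> poly_values B k (inverse x)" and "k \<le> Suc n"
  shows "inverse p \<in> poly_values B n x"
proof -
  obtain f where f: "\<And>i. f i \<in> B" "inverse p = (\<Sum>i\<le>Suc n. f i * x ^ i)"
    using poly_values_eq[OF n] by blast
  obtain h where h: "\<And>i. h i \<in> B" "inverse p = (\<Sum>i\<le>k. h i * inverse x ^ i)"
    using poly_values_eq[OF k] by blast
  \<comment> \<open>\<open>e\<close> inverts \<open>1 - p * h 0\<close>: the hypothesis
    \<open>unit\<close> is used with \<open>c = - h 0\<close>.\<close>
  define e where "e = inverse (1 + p * (- h 0))"
  have e: "e \<in> B" and e': "e * (1 - p * h 0) = 1"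
    using unit[OF subring_minus[OF B h(1)], of 0] by (auto simp: e_def)
  have "1 = p * (\<Sum>i\<le>k. h i * inverse x ^ i)"
    using h(2) p(2) by (metis right_inverse)
  also have "\<dots> = p * h 0 + p * (\<Sum>i=1..k. h i * inverse x ^ i)"
    by (simp add: atMost_atLeast0 sum.atLeast_Suc_atMost algebra_simps)
  finally have "1 - p * h 0 = p * (\<Sum>i=1..k. h i * inverse x ^ i)"
    by (simp only: diff_eq_eq add.commute)
  then have "1 = e * p * (\<Sum>i=1..k. h i * inverse x ^ i)"
    using e' by (metis mult.assoc)
  then have "f (Suc n) * x ^ Suc n = f (Suc n) * x ^ Suc n * (e * p * (\<Sum>i=1..k. h i * inverse x ^ i))"
    by simp
  \<comment> \<open>Since \<open>i\<close> starts at 1 and \<open>k\<close> is at most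
    \<open>Suc n\<close>, every exponent \<open>Suc n - i\<close> is a natural number not above
    \<open>n\<close>.\<close>
  also have "\<dots> = (\<Sum>i=1..k. f (Suc n) * e * p * h i * x ^ (Suc n - i))"
    unfolding sum_distrib_left
  proof (rule sum.cong)
    fix i assume "i \<in> {1..k}"
    then have "x ^ Suc n = x ^ (Suc n - i) * x ^ i"
      using \<open>k \<le> Suc n\<close> by (subst power_add[symmetric]) auto
    moreover have "x ^ i * inverse x ^ i = 1"
      using x by (simp add: power_inverse)
    ultimately show "f (Suc n) * x ^ Suc n * (e * p * (h i * inverse x ^ i)) =
        f (Suc n) * e * p * h i * x ^ (Suc n - i)"
      by (simp add: algebra_simps)
  qed simp
  also have "\<dots> \<in> poly_values B n x"
    using \<open>k \<le> Suc n\<close> f h e p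
    by (intro poly_values_sum poly_values_monom subring_mult B) auto
  finally have "f (Suc n) * x ^ Suc n \<in> poly_values B n x" .
  moreover have "(\<Sum>i\<le>n. f i * x ^ i) \<in> poly_values B n x"
    using f by (intro poly_values_sum poly_values_monom B) auto
  ultimately show ?thesis
    unfolding f(2) using poly_values_add[OF B] by fastforce
qed

text \<open>Chevalley's argument. If neither \<open>x\<close> nor \<open>inverse x\<close> were in
  \<open>B\<close>, then by maximality adjoining either one would make \<open>inverse p\<close>
  available. Of two such relations of least degree, the longer one can be shortened by means of the
  other.\<close>

lemma maximal_subring_valuation:
  fixes p :: "'a::field"
  assumes B: "unital_subring B" and p: "p \<in> B" "inverse p \<notin> B"
    and max: "\<And>C. unital_subring C \<Longrightarrow> B \<subseteq> C \<Longrightarrow> inverse p \<notin> C \<Longrightarrow> C = B"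
  shows "x \<in> B \<or> inverse x \<in> B"
proof (rule ccontr)
  assume neg: "\<not> (x \<in> B \<or> inverse x \<in> B)"
  have p0: "p \<noteq> 0" using p by auto
  have x0: "x \<noteq> 0" using neg subring_0[OF B] by auto
  have nz: "1 + p * c \<noteq> 0" if "c \<in> B" for c
  proof
    assume "1 + p * c = 0"
    then have "inverse p = - c" using p0 by (simp add: field_simps eq_neg_iff_add_eq_0)
    then show False using p that subring_minus[OF B] by auto
  qed
  \<comment> \<open>The localisation of \<open>B\<close> at \<open>1 + p B\<close>. It still misses
    \<open>inverse p\<close>, so it equals \<open>B\<close>, and all elements of
    \<open>1 + p B\<close> are units of \<open>B\<close>.\<close>
  define L where "L = {b / (1 + p * c) |b c. b \<in> B \<and> c \<in> B}"
  have "L = B"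
  proof (rule max)
    show "unital_subring L"
      unfolding unital_subring_def
    proof (intro conjI ballI)
      show "1 \<in> L" unfolding L_def using subring_0[OF B] subring_1[OF B]
        by (intro CollectI exI[of _ 1] exI[of _ 0]) auto
    next
      fix u v assume "u \<in> L" "v \<in> L"
      then obtain b c b' c' where *: "u = b / (1 + p * c)" "v = b' / (1 + p * c')"
        "b \<in> B" "c \<in> B" "b' \<in> B" "c' \<in> B" by (auto simp: L_def)
      \<comment> \<open>The common denominator: \<open>1 + p * d\<close> is the product of the two
        given ones.\<close>
      define d where "d = c + c' + p * c * c'"
      have d: "d \<in> B" "1 + p * d = (1 + p * c) * (1 + p * c')"
        unfolding d_def using * p
        by (auto intro!: subring_add[OF B] subring_mult[OF B] simp: algebra_simps)
      have "u - v = (b * (1 + p * c') - b' * (1 + p * c)) / (1 + p * d)"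
        unfolding d *(1,2) using nz[OF *(4)] nz[OF *(6)] by (simp add: diff_frac_eq)
      then show "u - v \<in> L"
        unfolding L_def using * p d
        by (intro CollectI exI[of _ "b * (1 + p * c') - b' * (1 + p * c)"] exI[of _ d])
          (auto intro!: subring_add[OF B] subring_mult[OF B] subring_diff[OF B] subring_1[OF B])
      have "u * v = (b * b') / (1 + p * d)"
        unfolding d *(1,2) by simp
      then show "u * v \<in> L"
        unfolding L_def using * p d
        by (intro CollectI exI[of _ "b * b'"] exI[of _ d]) (auto intro!: subring_mult[OF B])
    qed
    show "B \<subseteq> L"
    proof
      fix b assume "b \<in> B"
      then show "b \<in> L"
        unfolding L_def using subring_0[OF B] by (intro CollectI exI[of _ b] exI[of _ 0]) auto
    qed
    show "inverse p \<notin> L"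
    proof
      assume "inverse p \<in> L"
      then obtain b c where "inverse p = b / (1 + p * c)" "b \<in> B" "c \<in> B" by (auto simp: L_def)
      then have "inverse p = b - c"
        using nz[of c] p0 by (simp add: field_simps)
      then show False using p \<open>b \<in> B\<close> \<open>c \<in> B\<close> subring_diff[OF B] by auto
    qed
  qed
  moreover have "inverse (1 + p * c) \<in> L" if "c \<in> B" for c
    unfolding L_def using that subring_1[OF B]
    by (intro CollectI exI[of _ 1] exI[of _ c]) (auto simp: divide_inverse)
  ultimately have unit: "inverse (1 + p * c) \<in> B" if "c \<in> B" for c
    using that by blast
  have ex: "\<exists>n. inverse p \<in> poly_values B n y" if "y \<notin> B" for y
  proof (rule ccontr)
    assume "\<nexists>n. inverse p \<in> poly_values B n y"
    moreover have "B \<subseteq> (\<Union>n. poly_values B n y)"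
      using poly_values_monom[OF B, of _ 0 0 y] by auto
    moreover have "1 * y ^ 1 \<in> poly_values B 1 y"
      by (intro poly_values_monom[OF B] subring_1[OF B]) auto
    then have "y \<in> (\<Union>n. poly_values B n y)" by auto
    ultimately show False using max[OF subring_adjoin[OF B]] that by blast
  qed
  define d where "d y = (LEAST n. inverse p \<in> poly_values B n y)" for y
  have dI: "inverse p \<in> poly_values B (d x) x" "inverse p \<in> poly_values B (d (inverse x)) (inverse x)"
    unfolding d_def using ex neg by (auto intro: LeastI_ex)
  have d_least: "d y \<le> n" if "inverse p \<in> poly_values B n y" for n y
    unfolding d_def using that by (rule Least_le)
  \<comment> \<open>Formulated for a general \<open>y\<close> so that \<open>y\<close> may be
    whichever of \<open>x\<close> and \<open>inverse x\<close> has the larger least degree. Degree 0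
    would put \<open>inverse p\<close> into \<open>B\<close> itself.\<close>
  have "False" if xy: "y \<noteq> 0" "inverse p \<in> poly_values B (d y) y"
    "inverse p \<in> poly_values B (d (inverse y)) (inverse y)" "d (inverse y) \<le> d y" for y
  proof (cases "d y")
    case 0
    then obtain q where "degree q = 0" "\<forall>i. coeff q i \<in> B" "inverse p = poly q y"
      using xy by (auto simp: poly_values_def)
    moreover from this obtain c where "q = [:c:]" by (metis degree_eq_zeroE)
    ultimately show False using p by (metis add.right_neutral coeff_pCons_0 mult_zero_right poly_0 poly_pCons)
  next
    case (Suc n)
    have "inverse p \<in> poly_values B n y"
      using poly_values_degree_descent[OF B xy(1) unit nz p(1) p0 xy(2)[unfolded Suc] xy(3)] xy(4) Suc by simp
    then show False using d_least Suc by fastforce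
  qed
  from this[of x] this[of "inverse x"] show False
    using dI x0 by (cases "d (inverse x) \<le> d x") auto
qed

text \<open>Zorn's lemma yields a maximal subring among those that contain \<open>A\<close> but not
  \<open>inverse p\<close>. A ring above it contains \<open>A\<close> as well, so it is maximal in
  the sense of \<open>maximal_subring_valuation\<close>.\<close>

lemma exists_valuation_ring:
  fixes p :: "'a::field"
  assumes "unital_subring A" "p \<in> A" "inverse p \<notin> A"
  obtains B where "unital_subring B" "A \<subseteq> B" "inverse p \<notin> B" "\<And>x. x \<in> B \<or> inverse x \<in> B"
proof -
  define \<A> where "\<A> = {B. unital_subring B \<and> A \<subseteq> B \<and> inverse p \<notin> B}"
  have "\<exists>M\<in>\<A>. \<forall>X\<in>\<A>. M \<subseteq> X \<longrightarrow> X = M"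
  proof (rule subset_Zorn_nonempty)
    show "\<A> \<noteq> {}" using assms by (auto simp: \<A>_def)
  next
    fix \<C> assume ne: "\<C> \<noteq> {}" and chain: "subset.chain \<A> \<C>"
    have sub: "unital_subring C" "A \<subseteq> C" "inverse p \<notin> C" if "C \<in> \<C>" for C
      using chain that by (auto simp: subset.chain_def \<A>_def)
    have "unital_subring (\<Union>\<C>)"
      unfolding unital_subring_def
    proof (intro conjI ballI)
      show "1 \<in> \<Union>\<C>" using ne sub subring_1 by blast
    next
      fix x y assume "x \<in> \<Union>\<C>" "y \<in> \<Union>\<C>"
      then obtain C D where "C \<in> \<C>" "D \<in> \<C>" "x \<in> C" "y \<in> D" by blast
      moreover from this have "C \<subseteq> D \<or> D \<subseteq> C"
        using chain by (auto simp: subset.chain_def)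
      ultimately obtain X where X: "X \<in> \<C>" "x \<in> X" "y \<in> X" by blast
      show "x - y \<in> \<Union>\<C>" "x * y \<in> \<Union>\<C>"
        using X subring_diff[OF sub(1)] subring_mult[OF sub(1)] by blast+
    qed
    moreover have "A \<subseteq> \<Union>\<C>" using ne sub by blast
    ultimately show "\<Union>\<C> \<in> \<A>"
      using sub by (auto simp: \<A>_def)
  qed
  then obtain B where B: "B \<in> \<A>" "\<And>X. X \<in> \<A> \<Longrightarrow> B \<subseteq> X \<Longrightarrow> X = B" by blast
  show ?thesis
  proof (rule that[of B])
    show "x \<in> B \<or> inverse x \<in> B" for x
      by (rule maximal_subring_valuation[of B p]) (use B assms in \<open>auto simp: \<A>_def\<close>)
  qed (use B in \<open>auto simp: \<A>_def\<close>)
qed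

subsection \<open>Roots of unity and 2-adic size of sines and cosines\<close>

definition valuation_subring :: "'a::field set \<Rightarrow> bool" where
  "valuation_subring B \<longleftrightarrow> unital_subring B \<and> (\<forall>x. x \<in> B \<or> inverse x \<in> B)"

text \<open>Integral closedness in its simplest instance: if \<open>inverse w\<close> is in
  \<open>B\<close>, so is its power \<open>inverse w ^ (n - 1)\<close>, which is
  \<open>w\<close>.\<close>

lemma valuation_unity_root:
  assumes "valuation_subring B" "w ^ n = 1" "n > 0"
  shows "w \<in> B"
proof (cases "w \<in> B")
  case False
  then have "inverse w \<in> B" using assms by (auto simp: valuation_subring_def)
  then have "inverse w ^ (n - 1) \<in> B" using assms by (auto simp: valuation_subring_def subring_power)
  moreover have "w * w ^ (n - 1) = 1" using assms by (metis power_eq_if not_gr_zero)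
  then have "inverse w ^ (n - 1) = w" by (metis power_inverse inverse_inverse_eq inverse_unique)
  ultimately show ?thesis by simp
qed

text \<open>Descent on the exponent \<open>n\<close>. For even \<open>n\<close>, \<open>w\<close> is
  replaced by its square, and \<open>-1\<close> is excluded because it differs from 1 by only one
  factor 2 too few. For odd \<open>n\<close> and \<open>w\<close> other than 1, the vanishing
  geometric sum of \<open>n\<close> terms is congruent to the odd number \<open>n\<close> modulo 2,
  which would make 2 a unit.\<close>

lemma unity_root_cong_1_mod_4:
  fixes w :: "'a::field_char_0"
  assumes B: "unital_subring B" and half: "inverse 2 \<notin> B"
  shows "w ^ n = 1 \<Longrightarrow> n > 0 \<Longrightarrow> (w - 1) / 4 \<in> B \<Longrightarrow> w = 1"
proof (induction n arbitrary: w rule: less_induct)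
  case (less n)
  define u where "u = (w - 1) / 4"
  have w1: "w - 1 = 4 * u" unfolding u_def by simp
  then have u: "u \<in> B" "w = 1 + 4 * u"
    using less.prems(3) by (simp_all add: u_def[symmetric] diff_eq_eq add.commute)
  have num: "2 \<in> B" "4 \<in> B" using subring_of_nat[OF B, of 2] subring_of_nat[OF B, of 4] by auto
  have wB: "w \<in> B" unfolding u using u num by (intro subring_add[OF B] subring_mult[OF B] subring_1[OF B])
  show ?case
  proof (cases "even n")
    case True
    then obtain k where k: "n = 2 * k" by blast
    have "(w\<^sup>2 - 1) / 4 = u * (w + 1)" unfolding u by (simp add: power2_eq_square field_simps)
    moreover have "u * (w + 1) \<in> B"
      using u wB by (intro subring_add[OF B] subring_mult[OF B] subring_1[OF B])
    moreover have "(w\<^sup>2) ^ k = 1" using less.prems k by (simp add: power_mult)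
    ultimately have "w\<^sup>2 = 1" using less.IH[of k "w\<^sup>2"] less.prems k by auto
    moreover have "w \<noteq> -1"
    proof
      assume "w = -1"
      then have "2 * (- u) = 1" by (simp add: u_def)
      then have "inverse 2 = - u" by (rule inverse_unique)
      then show False using half subring_minus[OF B u(1)] by metis
    qed
    ultimately show ?thesis by (simp add: power2_eq_1_iff)
  next
    case False
    show ?thesis
    proof (rule ccontr)
      assume "w \<noteq> 1"
      \<comment> \<open>All powers of \<open>w\<close> are 1 modulo 2, so a sum of \<open>k\<close>
        of them is \<open>k\<close> modulo 2.\<close>
      have "\<exists>r\<in>B. (\<Sum>i<k. w ^ i) = of_nat k + 2 * r" for k
      proof (induction k)
        case 0
        then show ?case using subring_0[OF B] by (intro bexI[of _ 0]) auto
      next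
        case (Suc k)
        then obtain r where r: "r \<in> B" "(\<Sum>i<k. w ^ i) = of_nat k + 2 * r" by blast
        have "(w ^ k - 1) = (w - 1) * (\<Sum>i<k. w ^ i)" by (simp add: power_diff_1_eq)
        then have "w ^ k = (4 * u) * (\<Sum>i<k. w ^ i) + 1" unfolding w1 by (simp only: diff_eq_eq)
        then have "w ^ k = 1 + 2 * (2 * u * (\<Sum>i<k. w ^ i))" by simp
        moreover have "2 * u * (\<Sum>i<k. w ^ i) \<in> B"
          using u num wB by (intro subring_mult[OF B] subring_sum[OF B] subring_power[OF B])
        ultimately show ?case
          using r by (intro bexI[of _ "r + 2 * u * (\<Sum>i<k. w ^ i)"])
            (auto simp: algebra_simps intro!: subring_add[OF B])
      qed
      then obtain r where r: "r \<in> B" "(\<Sum>i<n. w ^ i) = of_nat n + 2 * r" by blast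
      have "(w - 1) * (\<Sum>i<n. w ^ i) = 0" using less.prems by (simp flip: power_diff_1_eq)
      then have "of_nat n + 2 * r = 0" using r \<open>w \<noteq> 1\<close> by simp
      moreover obtain k where "n = 2 * k + 1" using False by (blast elim: oddE)
      ultimately have "inverse 2 = - (of_nat k + r)"
        by (simp add: field_simps eq_neg_iff_add_eq_0)
      then show False
        using half subring_minus[OF B] subring_add[OF B] subring_of_nat[OF B] r by metis
    qed
  qed
qed

text \<open>Squaring improves the congruence from modulo 2 to modulo 4: with
  \<open>h = (w - 1) / 2\<close>, the quotient for the square is \<open>h * (h + 1)\<close>.\<close>

lemma unity_root_cong_1_mod_2:
  fixes w :: "'a::field_char_0"
  assumes B: "unital_subring B" and half: "inverse 2 \<notin> B"
    and w: "w ^ n = 1" "n > 0" "(w - 1) / 2 \<in> B"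
  shows "w\<^sup>2 = 1"
proof (rule unity_root_cong_1_mod_4[OF B half])
  show "(w\<^sup>2) ^ n = 1" using w by (metis power_commutes power_mult power_one mult.commute)
  have "(w\<^sup>2 - 1) / 4 = (w - 1) / 2 * ((w - 1) / 2 + 1)"
    by (simp add: power2_eq_square field_simps)
  then show "(w\<^sup>2 - 1) / 4 \<in> B"
    using w subring_add[OF B] subring_mult[OF B] subring_1[OF B] by metis
qed fact

lemma exists_dyadic_valuation_complex:
  obtains B :: "complex set" where "valuation_subring B" "inverse 2 \<notin> B"
proof -
  have "inverse 2 \<notin> (\<int> :: complex set)"
  proof
    assume "inverse 2 \<in> (\<int> :: complex set)"
    then obtain k where "inverse 2 = (of_int k :: complex)" by (auto elim: Ints_cases)
    then have "of_int (2 * k) = (1 :: complex)" by (simp add: field_simps)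
    then have "2 * k = 1" by (metis of_int_eq_1_iff)
    then show False by presburger
  qed
  moreover have "unital_subring (\<int> :: complex set)" by (auto simp: unital_subring_def)
  ultimately show ?thesis
    using exists_valuation_ring[of "\<int> :: complex set" 2] that
    by (metis Ints_numeral valuation_subring_def)
qed

text \<open>The previous lemma is applied to \<open>w\<close> and to \<open>- w\<close>. The two
  quotients are \<open>1 + 2 / (w - 1)\<close> and \<open>1 - 2 / (w + 1)\<close>, where the
  fractions are inverses of elements outside \<open>B\<close>, hence in \<open>B\<close>.\<close>

lemma half_unity_root_minus_1:
  fixes w :: complex
  assumes B: "valuation_subring B" "inverse 2 \<notin> B"
    and w: "w ^ n = 1" "n > 0" "w\<^sup>2 \<noteq> 1"
  shows "(w - 1) / 2 \<notin> B" "(w + 1) / 2 \<notin> B" "(w + 1) / (w - 1) \<in> B" "(w - 1) / (w + 1) \<in> B"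
proof -
  have sub: "unital_subring B" and val: "inverse x \<in> B" if "x \<notin> B" for x
    using B that by (auto simp: valuation_subring_def)
  show 1: "(w - 1) / 2 \<notin> B"
    using unity_root_cong_1_mod_2[of B w n] sub B w by (auto simp: valuation_subring_def)
  \<comment> \<open>The exponent is doubled because \<open>n\<close> may be odd.\<close>
  have "(- w) ^ (2 * n) = w ^ (2 * n)" by simp
  also have "\<dots> = 1" using w by (simp only: power_even_eq power_one)
  finally have "(- w) ^ (2 * n) = 1" .
  then have "(- w - 1) / 2 \<notin> B"
    using unity_root_cong_1_mod_2[of B "- w" "2 * n"] B w by (auto simp: valuation_subring_def)
  moreover have "(- w - 1) / 2 = - ((w + 1) / 2)" by (simp add: field_simps)
  ultimately show 2: "(w + 1) / 2 \<notin> B"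
    using sub[OF 1] subring_minus by metis
  have "w \<noteq> 1" "w \<noteq> -1" using w by auto
  then have "(w + 1) / (w - 1) = 1 + inverse ((w - 1) / 2)" "(w - 1) / (w + 1) = 1 - inverse ((w + 1) / 2)"
    by (auto simp: field_simps add_eq_0_iff)
  then show "(w + 1) / (w - 1) \<in> B" "(w - 1) / (w + 1) \<in> B"
    using val[OF 1] val[OF 2] sub[OF 1] subring_add subring_diff subring_1 by metis+
qed

text \<open>With \<open>w\<close> the square of \<open>cis t\<close>, the numbers
  \<open>(w + 1) / 2\<close> and \<open>(w - 1) / 2\<close> are \<open>cos t\<close> and
  \<open>sin t\<close> times roots of unity, which lie in the complex ring. Intersecting that ring
  with the reals gives \<open>B\<close>. The condition on \<open>sin (2 * t)\<close> ensures that
  the square of \<open>w\<close> is not 1.\<close>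

lemma exists_dyadic_valuation_real:
  obtains B :: "real set" where "valuation_subring B"
    "\<And>t n. \<lbrakk>n > 0; sin (2 * t) \<noteq> 0; cis (t * real n) = 1\<rbrakk> \<Longrightarrow>
      cos t \<notin> B \<and> sin t \<notin> B \<and> cos t / sin t \<in> B \<and> sin t / cos t \<in> B"
proof -
  obtain C :: "complex set" where C: "valuation_subring C" "inverse 2 \<notin> C"
    by (rule exists_dyadic_valuation_complex)
  have sub: "unital_subring C" using C by (auto simp: valuation_subring_def)
  define B where "B = {x :: real. of_real x \<in> C}"
  show ?thesis
  proof (rule that[of B])
    show "valuation_subring B"
      using C subring_1[OF sub] subring_diff[OF sub] subring_mult[OF sub]
      by (auto simp: B_def valuation_subring_def unital_subring_def simp flip: of_real_inverse)
  next
    fix t :: real and n :: nat assume n: "n > 0" "sin (2 * t) \<noteq> 0" "cis (t * real n) = 1"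
    have e: "cis t ^ n = 1" using n by (simp only: Complex.DeMoivre mult.commute[of t])
    have eC: "cis t \<in> C" using valuation_unity_root[OF C(1) e n(1)] .
    have iC: "\<i> \<in> C" using valuation_unity_root[OF C(1), of \<i> 4] by simp
    define w where "w = cis t ^ 2"
    have w2: "w\<^sup>2 \<noteq> 1"
    proof
      assume "w\<^sup>2 = 1"
      then have "cis (4 * t) = 1" by (simp add: w_def Complex.DeMoivre power_mult[symmetric])
      then have "sin (4 * t) = 0" "cos (4 * t) = 1" by (auto simp: complex_eq_iff)
      then show False using n(2) cos_double_sin[of "2 * t"] by simp
    qed
    have wn: "w ^ n = 1" using e by (metis w_def power_commutes power_mult power_one mult.commute)
    note W = half_unity_root_minus_1[OF C wn n(1) w2]
    have w0: "w \<noteq> 1" "w \<noteq> -1" using w2 by auto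
    have "of_real (cos t) = (cis t + cis (- t)) / 2" "of_real (sin t) * \<i> = (cis t - cis (- t)) / 2"
      by (simp_all add: complex_eq_iff)
    note eqs = this
    have c: "of_real (cos t) * cis t = (w + 1) / 2" and s: "of_real (sin t) * \<i> * cis t = (w - 1) / 2"
      unfolding eqs by (simp_all add: w_def power2_eq_square left_diff_distrib distrib_right cis_mult)
    have s0: "sin t \<noteq> 0" "cos t \<noteq> 0" using n by (auto simp: sin_double)
    have c2: "w + 1 = 2 * (of_real (cos t) * cis t)" and s2: "w - 1 = 2 * (of_real (sin t) * \<i> * cis t)"
      unfolding c s by simp_all
    have "(w + 1) / (w - 1) = of_real (cos t) / (of_real (sin t) * \<i>)"
      unfolding c2 s2 by simp
    then have "of_real (cos t / sin t) = \<i> * ((w + 1) / (w - 1))" by simp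
    then have cot: "cos t / sin t \<in> B"
      using W(3) iC subring_mult[OF sub] unfolding B_def mem_Collect_eq by metis
    have "(w - 1) / (w + 1) = (of_real (sin t) * \<i>) / of_real (cos t)"
      unfolding c2 s2 by simp
    moreover have "\<i> * (complex_of_real (sin t) * \<i>) = - of_real (sin t)" by (simp add: complex_eq_iff)
    ultimately have "of_real (sin t / cos t) = - (\<i> * ((w - 1) / (w + 1)))" by simp
    then have "sin t / cos t \<in> B"
      using W(4) iC subring_mult[OF sub] subring_minus[OF sub] unfolding B_def mem_Collect_eq by metis
    moreover have "cos t \<notin> B" "sin t \<notin> B"
      using c s W(1,2) iC eC subring_mult[OF sub] unfolding B_def mem_Collect_eq by metis+
    ultimately show "cos t \<notin> B \<and> sin t \<notin> B \<and> cos t / sin t \<in> B \<and> sin t / cos t \<in> B"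
      using cot by blast
  qed
qed

subsection \<open>Modules spanned by the entries of a vector\<close>

text \<open>Over a valuation ring one entry divides all others, so these multiples of single entries
  already form the submodule generated by the entries. Inclusion of spans replaces comparison of
  valuations, and no value group has to be constructed.\<close>

definition entry_span :: "'a::comm_ring_1 set \<Rightarrow> 'a^'n \<Rightarrow> 'a set" where
  "entry_span B v = {b * v $ j |b j. b \<in> B}"

context
  fixes B :: "'a::field set"
  assumes val: "valuation_subring B"
begin

lemma val_subring: "unital_subring B"
  using val by (simp add: valuation_subring_def)

lemma val_total: "x \<in> B \<or> inverse x \<in> B"
  using val by (simp add: valuation_subring_def)

text \<open>Divisibility in a valuation ring is a total preorder, so among finitely many entries one
  divides every other.\<close>

lemma entry_span_generator: obtains j where "entry_span B v = {b * v $ j |b. b \<in> B}"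
proof -
  define D where "D i j \<longleftrightarrow> (\<exists>b\<in>B. v $ i = b * v $ j)" for i j
  have "\<exists>j. \<forall>i\<in>I. D i j" if "finite I" for I :: "'b set"
    using that
  proof (induction I)
    case (insert i I)
    then obtain j where j: "\<forall>k\<in>I. D k j" by blast
    have refl: "D k k" for k unfolding D_def by (intro bexI[of _ 1] subring_1[OF val_subring]) simp
    have trans: "D k l" if kjl: "D k j'" "D j' l" for k l j'
    proof -
      obtain b c where "b \<in> B" "c \<in> B" "v $ k = b * v $ j'" "v $ j' = c * v $ l"
        using kjl unfolding D_def by blast
      then show ?thesis
        unfolding D_def by (intro bexI[of _ "b * c"] subring_mult[OF val_subring]) auto
    qed
    have "D i j \<or> D j i"
    proof (cases "v $ i = 0 \<or> v $ j = 0")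
      case True
      then show ?thesis unfolding D_def using subring_0[OF val_subring] by (metis mult_zero_left)
    next
      case False
      then have "v $ i = (v $ i / v $ j) * v $ j" "v $ j = inverse (v $ i / v $ j) * v $ i" by auto
      then show ?thesis unfolding D_def using val_total[of "v $ i / v $ j"] by metis
    qed
    then show ?case using j refl trans by (metis insertE)
  qed auto
  from this[of UNIV] obtain j where j: "\<And>i. D i j" by auto
  show ?thesis
  proof (rule that[of j], intro equalityI subsetI)
    fix x assume "x \<in> entry_span B v"
    then obtain b i where "b \<in> B" "x = b * v $ i" by (auto simp: entry_span_def)
    moreover obtain c where "c \<in> B" "v $ i = c * v $ j" using j[of i] by (auto simp: D_def)
    ultimately show "x \<in> {b * v $ j |b. b \<in> B}"
      by (intro CollectI exI[of _ "b * c"]) (auto intro: subring_mult[OF val_subring])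
  qed (auto simp: entry_span_def)
qed

lemma entry_span_entry: "v $ j \<in> entry_span B v"
  unfolding entry_span_def using subring_1[OF val_subring]
  by (intro CollectI exI[of _ 1] exI[of _ j]) simp

lemma entry_span_mult: "b \<in> B \<Longrightarrow> x \<in> entry_span B v \<Longrightarrow> b * x \<in> entry_span B v"
  unfolding entry_span_def using subring_mult[OF val_subring] by clarify (metis mult.assoc)

lemma entry_span_diff: "x \<in> entry_span B v \<Longrightarrow> y \<in> entry_span B v \<Longrightarrow> x - y \<in> entry_span B v"
proof -
  assume *: "x \<in> entry_span B v" "y \<in> entry_span B v"
  obtain j where "entry_span B v = {b * v $ j |b. b \<in> B}" by (rule entry_span_generator)
  then show ?thesis
    using * subring_diff[OF val_subring] by (auto simp flip: left_diff_distrib)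
qed

lemma entry_span_0: "0 \<in> entry_span B v"
  using entry_span_diff[OF entry_span_entry entry_span_entry, of v undefined undefined] by simp

lemma entry_span_add: "x \<in> entry_span B v \<Longrightarrow> y \<in> entry_span B v \<Longrightarrow> x + y \<in> entry_span B v"
  using entry_span_diff[of x v "- y"] entry_span_diff[OF entry_span_0, of y v] by simp

lemma entry_span_sum: "(\<And>i. i \<in> A \<Longrightarrow> f i \<in> entry_span B v) \<Longrightarrow> sum f A \<in> entry_span B v"
  by (induction A rule: infinite_finite_induct) (auto simp: entry_span_0 entry_span_add)

lemma entry_span_subset_iff: "entry_span B v \<subseteq> entry_span B w \<longleftrightarrow> (\<forall>j. v $ j \<in> entry_span B w)"
proof
  show "entry_span B v \<subseteq> entry_span B w" if "\<forall>j. v $ j \<in> entry_span B w"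
    using that entry_span_mult unfolding entry_span_def[of B v] by blast
qed (use entry_span_entry in auto)

text \<open>The quotient of two nonzero generators or its inverse lies in \<open>B\<close>, which
  decides the direction.\<close>

lemma entry_span_linear: "entry_span B v \<subseteq> entry_span B w \<or> entry_span B w \<subseteq> entry_span B v"
proof -
  obtain i where i: "entry_span B v = {b * v $ i |b. b \<in> B}" by (rule entry_span_generator)
  obtain j where j: "entry_span B w = {b * w $ j |b. b \<in> B}" by (rule entry_span_generator)
  show ?thesis
  proof (cases "v $ i = 0 \<or> w $ j = 0")
    case True
    then show ?thesis using i j entry_span_0[of v] entry_span_0[of w] by auto
  next
    case False
    have *: "entry_span B a \<subseteq> entry_span B b"
      if "entry_span B a = {c * x |c. c \<in> B}" "x \<in> entry_span B b" for a b x
      using that entry_span_mult by auto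
    have "v $ i = (v $ i / w $ j) * w $ j" "w $ j = inverse (v $ i / w $ j) * v $ i"
      using False by auto
    then show ?thesis
      using *[OF i, of w] *[OF j, of v] entry_span_mult[OF _ entry_span_entry, of _ w j]
        entry_span_mult[OF _ entry_span_entry, of _ v i] val_total[of "v $ i / w $ j"] by metis
  qed
qed

lemma entry_span_minus: "entry_span B (- v) = entry_span B v"
  unfolding entry_span_def using subring_minus[OF val_subring]
  by auto (metis minus_minus mult_minus_left mult_minus_right)+

lemma entry_span_smult: "entry_span B (c *s v) = (*) c ` entry_span B v"
  unfolding entry_span_def by (auto simp: algebra_simps image_iff) blast+

lemma entry_span_smult_unit:
  assumes "c \<in> B" "inverse c \<in> B" "c \<noteq> 0"
  shows "entry_span B (c *s v) = entry_span B v"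
proof
  show "entry_span B (c *s v) \<subseteq> entry_span B v"
    unfolding entry_span_smult using assms entry_span_mult by blast
  show "entry_span B v \<subseteq> entry_span B (c *s v)"
  proof
    fix x assume "x \<in> entry_span B v"
    then have "inverse c * x \<in> entry_span B v" using assms entry_span_mult by blast
    moreover have "x = c * (inverse c * x)" using assms by simp
    ultimately show "x \<in> entry_span B (c *s v)" unfolding entry_span_smult by blast
  qed
qed

text \<open>As \<open>inverse s\<close> is in \<open>B\<close>, scaling by \<open>s\<close> can only
  enlarge the span. The enlargement is strict for nonzero \<open>v\<close>, which the strictly
  smaller span of \<open>w\<close> guarantees.\<close>

lemma entry_span_smult_psubset:
  assumes "s \<notin> B" and v: "entry_span B w \<subset> entry_span B v"
  shows "entry_span B v \<subset> entry_span B (s *s v)"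
proof -
  obtain j where j: "entry_span B v = {b * v $ j |b. b \<in> B}" by (rule entry_span_generator)
  have vj: "v $ j \<noteq> 0"
    using j v entry_span_0[of w] by auto
  have s: "inverse s \<in> B" "s \<noteq> 0" using assms val_total subring_0[OF val_subring] by metis+
  have "entry_span B v \<subseteq> entry_span B (s *s v)"
  proof
    fix x assume "x \<in> entry_span B v"
    then have "inverse s * x \<in> entry_span B v" using s entry_span_mult by blast
    moreover have "x = s * (inverse s * x)" using s by simp
    ultimately show "x \<in> entry_span B (s *s v)" unfolding entry_span_smult by blast
  qed
  moreover have "s * v $ j \<notin> entry_span B v" using assms j vj by auto
  moreover have "s * v $ j \<in> entry_span B (s *s v)" unfolding entry_span_smult using entry_span_entry by blast
  ultimately show ?thesis by blast
qed

text \<open>The ultrametric principle: otherwise \<open>v\<close>, being the difference of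
  \<open>v + w\<close> and \<open>w\<close>, would lie in the larger of two spans that are both too
  small.\<close>

lemma entry_span_add_dominant:
  fixes v w :: "'a^'n"
  assumes "entry_span B w \<subset> entry_span B v"
  shows "entry_span B (v + w) = entry_span B v"
proof (rule ccontr)
  assume "entry_span B (v + w) \<noteq> entry_span B v"
  moreover have "entry_span B (v + w) \<subseteq> entry_span B v"
    using assms entry_span_entry by (auto simp: entry_span_subset_iff intro!: entry_span_add)
  ultimately have less: "entry_span B (v + w) \<subset> entry_span B v" by blast
  obtain u :: "'a^'n" where u: "entry_span B w \<subseteq> entry_span B u" "entry_span B (v + w) \<subseteq> entry_span B u" "entry_span B u \<subset> entry_span B v"
    using entry_span_linear[of w "v + w"] assms less by blast
  have "v $ j \<in> entry_span B u" for j
    using entry_span_diff[of "(v + w) $ j" u "w $ j"] entry_span_entry[of "v + w" j] entry_span_entry[of w j] u by auto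
  then have "entry_span B v \<subseteq> entry_span B u" by (simp add: entry_span_subset_iff)
  then show False using u by blast
qed

text \<open>Taking out \<open>s\<close> leaves \<open>v\<close> plus a unit multiple of
  \<open>w\<close>, and \<open>v\<close> dominates.\<close>

lemma entry_span_combination:
  assumes "entry_span B w \<subset> entry_span B v" "c / s \<in> B" "s / c \<in> B" "s \<noteq> 0" "c \<noteq> 0"
  shows "entry_span B (s *s v + c *s w) = entry_span B (s *s v)"
proof -
  have eq: "entry_span B ((c / s) *s w) = entry_span B w"
    using assms by (intro entry_span_smult_unit) auto
  have "s *s v + c *s w = s *s (v + (c / s) *s w)"
    using assms by (simp add: vector_add_ldistrib)
  moreover have "entry_span B (v + (c / s) *s w) = entry_span B v"
    using assms eq by (intro entry_span_add_dominant) simp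
  ultimately show ?thesis by (simp only: entry_span_smult)
qed

lemma entry_span_vector_matrix:
  fixes v :: "'a^'n" and E :: "'a^'m^'n"
  assumes "\<And>i j. E $ i $ j \<in> B"
  shows "entry_span B (v v* E) \<subseteq> entry_span B v"
  unfolding entry_span_subset_iff vector_matrix_mult_def
  using assms entry_span_entry[of v]
  by (auto intro!: entry_span_sum entry_span_mult simp: mult.commute[of "v $ _"])

end

subsection \<open>Rotation matrices and row sizes\<close>

lemma SO3_simps [simp]: "A \<otimes>\<^bsub>SO3\<^esub> B = A ** B" "\<one>\<^bsub>SO3\<^esub> = mat 1"
  by (simp_all add: SO3_def)

lemma carrier_SO3: "A \<in> carrier SO3 \<longleftrightarrow> rotation_matrix A"
  by (simp add: SO3_def)

lemma inv_SO3: "A \<in> carrier SO3 \<Longrightarrow> inv\<^bsub>SO3\<^esub> A = transpose A"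
  by (intro group.inv_equality[OF group_SO3])
    (auto simp: SO3_def rotation_matrix_def orthogonal_matrix_def orthogonal_matrix_transpose det_transpose)

lemmas matrix3_simps = vec_eq_iff forall_3 matrix_matrix_mult_def sum_3 vector_3 mat_def
  Rx_def Ry_def transpose_def

lemma Rx_add: "Rx a ** Rx b = Rx (a + b)"
  by (simp add: matrix3_simps cos_add sin_add algebra_simps)

lemma Rx_0: "Rx 0 = mat 1"
  by (simp add: matrix3_simps)

lemma transpose_Rx: "transpose (Rx a) = Rx (- a)"
  by (simp add: matrix3_simps)

lemma Rx_int_pow: "Rx t [^]\<^bsub>SO3\<^esub> (k::int) = Rx (of_int k * t)"
proof -
  have *: "Rx t [^]\<^bsub>SO3\<^esub> n = Rx (of_nat n * t)" for n :: nat
    by (induction n) (simp_all add: monoid.nat_pow_Suc[OF group.is_monoid[OF group_SO3]]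
        monoid.nat_pow_0[OF group.is_monoid[OF group_SO3]] Rx_add Rx_0 algebra_simps)
  show ?thesis
    by (simp add: int_pow_def2 * inv_SO3 R_in_SO3 transpose_Rx)
qed

lemma ST_word_simps:
  "ST_word m [] = mat 1"
  "ST_word m (a # as) = S ** (Rx (2 * pi * a / m) ** ST_word m as)"
  by (simp_all add: T_def Rx_int_pow matrix_mul_assoc mult_ac)

lemma ST_word_Cons_mult: "ST_word m (a # as) ** E = S ** (Rx (2 * pi * a / m) ** (ST_word m as ** E))"
  by (simp add: ST_word_simps matrix_mul_assoc del: ST_word.simps)

text \<open>The number of steps of \<open>T m\<close> that make up a half turn for even
  \<open>m\<close> and a full turn for odd \<open>m\<close>. Exponents are reduced modulo this
  number, at the cost of an element of \<open>klein m\<close>.\<close>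

definition half_period :: "nat \<Rightarrow> int" where
  "half_period m = (if even m then int m div 2 else int m)"

text \<open>A single integer inequality for both bounds: \<open>m / 2\<close> for odd
  \<open>m\<close> and \<open>m / 4\<close> for even \<open>m\<close>.\<close>

definition admissible :: "nat \<Rightarrow> int \<Rightarrow> bool" where
  "admissible m a \<longleftrightarrow> a \<noteq> 0 \<and> 2 * \<bar>a\<bar> < half_period m"

definition normal_word :: "nat \<Rightarrow> int list \<Rightarrow> bool" where
  "normal_word m as \<longleftrightarrow> (\<forall>a\<in>set as. admissible m a) \<and> (4 dvd m \<longrightarrow> as \<noteq> [] \<longrightarrow> last as > 0)"

lemma restrictions_iff:
  assumes "m > 0"
  shows "restrictions m (length as) W as \<longleftrightarrow>
    (W \<in> {mat 1, S ** S ** S} \<or> 4 dvd m \<and> W = U) \<and> normal_word m as \<and> (as = [] \<longrightarrow> W = mat 1)" (is "_ \<longleftrightarrow> ?rhs")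
proof -
  have S3: "S [^]\<^bsub>SO3\<^esub> (3::nat) = S ** S ** S"
    by (simp add: numeral_3_eq_3 monoid.nat_pow_Suc[OF group.is_monoid[OF group_SO3]]
        monoid.nat_pow_0[OF group.is_monoid[OF group_SO3]])
  consider "odd m" | k where "odd k" "m = 2 * k" | k where "m = 4 * k"
    by (metis dvd_def evenE mult.assoc mult_2 numeral_Bit0)
  then show ?thesis
  proof cases
    case 1
    then have nd: "\<not> 4 dvd m" "\<nexists>k. m = 2 * k" by presburger+
    have "real_of_int a \<in> {- (real m / 2)<..<real m / 2} \<and> a \<noteq> 0 \<longleftrightarrow> admissible m a" for a
      using 1 unfolding admissible_def half_period_def greaterThanLessThan_iff by (simp, linarith)
    then show ?thesis
      using 1 nd unfolding restrictions_def normal_word_def S3 by auto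
  next
    case 2
    then have nd: "\<not> 4 dvd m" "even m" by presburger+
    have "real_of_int a \<in> {- (real m / 4)<..<real m / 4} \<and> a \<noteq> 0 \<longleftrightarrow> admissible m a" for a
      using 2 unfolding admissible_def half_period_def greaterThanLessThan_iff by (simp, linarith)
    then show ?thesis
      using 2 nd unfolding restrictions_def normal_word_def S3 by auto
  next
    case 3
    then have nd: "4 dvd m" "even m" "\<not> (\<exists>k. odd k \<and> m = 2 * k)" by presburger+
    have *: "real_of_int a \<in> {- (real m / 4)<..<real m / 4} \<and> a \<noteq> 0 \<longleftrightarrow> admissible m a" for a
      using 3 unfolding admissible_def half_period_def greaterThanLessThan_iff by (simp, linarith)
    have **: "real_of_int a \<in> {0<..<real m / 4} \<longleftrightarrow> admissible m a \<and> a > 0" for a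
      using 3 unfolding admissible_def half_period_def greaterThanLessThan_iff by (simp, linarith)
    have "restrictions m (length as) W as \<longleftrightarrow> W \<in> {mat 1, S ** S ** S, U} \<and> (\<forall>a\<in>set as. admissible m a) \<and>
        (as \<noteq> [] \<longrightarrow> admissible m (last as) \<and> last as > 0) \<and> (as = [] \<longrightarrow> W = mat 1)"
      unfolding restrictions_def S3 * **
      by (simp only: nd SO3_simps simp_thms conj_assoc not_True_eq_False length_greater_0_conv length_0_conv)
    also have "\<dots> \<longleftrightarrow> ?rhs"
      using last_in_set[of as] nd(1) unfolding normal_word_def by blast
    finally show ?thesis .
  qed
qed

section \<open>Row sizes under multiplication by \<open>S\<close> and by rotations about the
  x-axis\<close>

lemma S_mult_rows: "(S ** A) $ 1 = A $ 3" "(S ** A) $ 2 = A $ 2" "(S ** A) $ 3 = - A $ 1"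
  by (simp_all add: matrix3_simps S_def)

lemma Rx_mult_rows: "(Rx t ** A) $ 1 = A $ 1" "(Rx t ** A) $ 2 = cos t *s A $ 2 + (- sin t) *s A $ 3"
  "(Rx t ** A) $ 3 = sin t *s A $ 2 + cos t *s A $ 3"
  by (simp_all add: matrix3_simps)

text \<open>Orthogonality puts the inverse, being the transpose, over \<open>B\<close> as
  well.\<close>

definition integral_in :: "real set \<Rightarrow> (real^3^3) set" where
  "integral_in B = {E. orthogonal_matrix E \<and> (\<forall>i j. E $ i $ j \<in> B)}"

text \<open>The invariant of nonempty normal words. Integral matrices, which is what the empty word
  leaves, are \<open>flat\<close> instead.\<close>

definition steep :: "real set \<Rightarrow> real^3^3 \<Rightarrow> bool" where
  "steep B A \<longleftrightarrow> entry_span B (A $ 1) = entry_span B (A $ 2) \<and> entry_span B (A $ 3) \<subset> entry_span B (A $ 2)"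

definition flat :: "real set \<Rightarrow> real^3^3 \<Rightarrow> bool" where
  "flat B A \<longleftrightarrow> (\<forall>i j. entry_span B (A $ i) = entry_span B (A $ j))"

text \<open>The two quotients say that sine and cosine have equal valuation; it is negative because
  neither lies in \<open>B\<close>.\<close>

definition tilting :: "real set \<Rightarrow> real \<Rightarrow> bool" where
  "tilting B t \<longleftrightarrow> cos t \<notin> B \<and> sin t \<notin> B \<and> cos t / sin t \<in> B \<and> sin t / cos t \<in> B"

context
  fixes B :: "real set"
  assumes val: "valuation_subring B"
begin

text \<open>Multiplication by \<open>E\<close> cannot enlarge the span of a row, and neither can
  multiplication by its transpose, which undoes \<open>E\<close>.\<close>

lemma entry_span_mult_integral:
  fixes A :: "real^3^'n"
  assumes "E \<in> integral_in B"
  shows "entry_span B ((A ** E) $ i) = entry_span B (A $ i)"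
proof -
  have row: "(M ** N) $ i = M $ i v* N" for M :: "real^3^'n" and N :: "real^3^3" and i
    by (simp add: vec_eq_iff matrix_matrix_mult_def vector_matrix_mult_def mult.commute)
  have E: "E ** transpose E = mat 1" "\<And>i j. E $ i $ j \<in> B" "\<And>i j. transpose E $ i $ j \<in> B"
    using assms by (auto simp: integral_in_def orthogonal_matrix_def transpose_def)
  have "entry_span B ((A ** E) $ i) \<subseteq> entry_span B (A $ i)"
    using entry_span_vector_matrix[OF val E(2), of "A $ i"] by (simp add: row)
  moreover have "A = A ** E ** transpose E"
    by (simp add: E flip: matrix_mul_assoc)
  then have "entry_span B (A $ i) \<subseteq> entry_span B ((A ** E) $ i)"
    using entry_span_vector_matrix[OF val E(3), of "(A ** E) $ i"] by (metis row)
  ultimately show ?thesis by blast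
qed

lemma entry_span_mat_1: "entry_span B ((mat 1 :: real^3^3) $ i) = B"
proof -
  have "{b * (if i = j then 1 else 0) |b j. b \<in> B} = B"
    (is "?L = _")
  proof (intro equalityI subsetI)
    show "x \<in> ?L" if "x \<in> B" for x
      using that by (intro CollectI exI[of _ x] exI[of _ i]) simp
  qed (use subring_0[OF val_subring[OF val]] in \<open>auto split: if_splits\<close>)
  then show ?thesis by (simp add: entry_span_def mat_def)
qed

lemma flat_integral: "E \<in> integral_in B \<Longrightarrow> flat B E"
  using entry_span_mult_integral[of E "mat 1"] entry_span_mat_1 by (simp add: flat_def)

lemma not_steep_flat: "steep B A \<Longrightarrow> \<not> flat B A"
  unfolding steep_def flat_def by (metis psubset_eq)

lemma tilting_nonzero: "tilting B t \<Longrightarrow> sin t \<noteq> 0 \<and> cos t \<noteq> 0"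
  unfolding tilting_def using subring_0[OF val_subring[OF val]] by metis

text \<open>The new rows 2 and 3 combine the old ones with coefficients of equal valuation, so the
  dominant old row 2 determines both sizes. Row 1 is unchanged and was as large as the old row 2,
  hence is now smaller by the non-integral factor \<open>sin t\<close>.\<close>

lemma Rx_steep_spans:
  assumes "steep B A" "tilting B t"
  defines "V \<equiv> entry_span B (sin t *s A $ 2)"
  shows "entry_span B ((Rx t ** A) $ 1) \<subset> V" "entry_span B ((Rx t ** A) $ 2) = V"
    "entry_span B ((Rx t ** A) $ 3) = V"
proof -
  have A: "entry_span B (A $ 3) \<subset> entry_span B (A $ 2)" "entry_span B (A $ 1) = entry_span B (A $ 2)"
    using assms(1) by (auto simp: steep_def)
  note nz = tilting_nonzero[OF assms(2)]
  have t: "cos t / sin t \<in> B" "sin t / cos t \<in> B" "sin t \<notin> B"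
    using assms(2) by (auto simp: tilting_def)
  show "entry_span B ((Rx t ** A) $ 1) \<subset> V"
    unfolding V_def Rx_mult_rows A by (rule entry_span_smult_psubset[OF val t(3) A(1)])
  show "entry_span B ((Rx t ** A) $ 3) = V"
    unfolding V_def Rx_mult_rows using A t nz by (intro entry_span_combination[OF val]) auto
  have "entry_span B ((Rx t ** A) $ 2) = entry_span B (cos t *s A $ 2)"
    unfolding Rx_mult_rows using A t nz subring_minus[OF val_subring[OF val]]
    by (intro entry_span_combination[OF val]) auto
  \<comment> \<open>\<open>cos t / sin t\<close> is a unit of \<open>B\<close>, so either factor
    gives the same span.\<close>
  also have "cos t *s A $ 2 = (cos t / sin t) *s (sin t *s A $ 2)"
    using nz by simp
  also have "entry_span B \<dots> = V"
    unfolding V_def using t nz by (intro entry_span_smult_unit[OF val]) auto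
  finally show "entry_span B ((Rx t ** A) $ 2) = V" .
qed

text \<open>Dropping \<open>E\<close> leaves the rows of \<open>Rx t\<close> itself: the first spans
  \<open>B\<close>, the other two have the same entries up to sign and span more than
  \<open>B\<close>.\<close>

lemma Rx_integral_spans:
  assumes "E \<in> integral_in B" "tilting B t"
  defines "V \<equiv> entry_span B (Rx t $ 2)"
  shows "entry_span B ((Rx t ** E) $ 1) \<subset> V" "entry_span B ((Rx t ** E) $ 2) = V"
    "entry_span B ((Rx t ** E) $ 3) = V"
proof -
  note minus = subring_minus[OF val_subring[OF val]]
  have rows: "Rx t $ 1 = vector [1, 0, 0]" "Rx t $ 2 = vector [0, cos t, - sin t]"
    "Rx t $ 3 = vector [0, sin t, cos t]" by (simp_all add: Rx_def vector_3)
  have V: "0 \<in> V" "cos t \<in> V" "- sin t \<in> V"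
    unfolding V_def using entry_span_entry[OF val, of "Rx t $ 2"]
    by (metis rows(2) vector_3)+
  have s: "sin t \<in> V"
    using entry_span_diff[OF val, of 0 "Rx t $ 2" "- sin t"] V by (simp add: V_def)
  have V3: "0 \<in> entry_span B (Rx t $ 3)" "sin t \<in> entry_span B (Rx t $ 3)" "cos t \<in> entry_span B (Rx t $ 3)"
    using entry_span_entry[OF val, of "Rx t $ 3"] by (metis rows(3) vector_3)+
  have "- sin t \<in> entry_span B (Rx t $ 3)"
    using entry_span_diff[OF val V3(1) V3(2)] by simp
  then have "entry_span B (Rx t $ 3) = V"
    using V V3 s unfolding V_def by (intro equalityI) (simp_all add: entry_span_subset_iff[OF val] forall_3 rows vector_3)
  then show "entry_span B ((Rx t ** E) $ 3) = V"
    using entry_span_mult_integral[OF assms(1)] by metis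
  show "entry_span B ((Rx t ** E) $ 2) = V"
    using entry_span_mult_integral[OF assms(1)] unfolding V_def by metis
  have R1: "entry_span B (Rx t $ 1) = B"
    using entry_span_mat_1[of 1] Rx_mult_rows(1)[of t "mat 1"] by simp
  have "inverse (sin t) \<in> B"
    using assms(2) val_total[OF val] by (auto simp: tilting_def)
  then have "inverse (sin t) * sin t \<in> V"
    using s entry_span_mult[OF val] by (simp add: V_def)
  then have "1 \<in> V" using tilting_nonzero[OF assms(2)] by simp
  then have "B \<subseteq> V" using entry_span_mult[OF val, of _ 1 "Rx t $ 2"] by (auto simp: V_def)
  moreover have "sin t \<notin> B" using assms(2) by (simp add: tilting_def)
  ultimately show "entry_span B ((Rx t ** E) $ 1) \<subset> V"
    using entry_span_mult_integral[OF assms(1), of "Rx t" 1] R1 s by auto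
qed

text \<open>The rotation leaves the first row as the small one; \<open>S\<close> exchanges it with
  the third, up to sign.\<close>

lemma steep_S_Rx:
  assumes "A \<in> integral_in B \<or> steep B A" "tilting B t"
  shows "steep B (S ** (Rx t ** A))"
proof -
  obtain V where "entry_span B ((Rx t ** A) $ 1) \<subset> V" "entry_span B ((Rx t ** A) $ 2) = V"
    "entry_span B ((Rx t ** A) $ 3) = V"
    using assms Rx_integral_spans[of A t] Rx_steep_spans[of A t] by blast
  then show ?thesis by (simp add: steep_def S_mult_rows entry_span_minus[OF val])
qed

text \<open>The small row is the first one, which fits neither of the two shapes that the tail of a
  word can have.\<close>

lemma not_steep_Rx:
  assumes "A \<in> integral_in B \<or> steep B A" "tilting B t"
  shows "\<not> steep B (Rx t ** A)" "\<not> flat B (Rx t ** A)"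
proof -
  obtain V where "entry_span B ((Rx t ** A) $ 1) \<subset> V" "entry_span B ((Rx t ** A) $ 2) = V"
    "entry_span B ((Rx t ** A) $ 3) = V"
    using assms Rx_integral_spans[of A t] Rx_steep_spans[of A t] by blast
  then show "\<not> steep B (Rx t ** A)" "\<not> flat B (Rx t ** A)"
    by (auto simp: steep_def flat_def) (metis psubset_eq)
qed

end

subsection \<open>Uniqueness\<close>

text \<open>The generators are two quarter turns and a full turn, with entries 0, 1 and -1; inverses
  are transposes.\<close>

lemma G_4_integer:
  assumes "g \<in> G 4 4 1"
  shows "orthogonal_matrix g \<and> (\<forall>i j. g $ i $ j \<in> \<int>)"
  using assms unfolding G_def
proof (induction rule: generate.induct)
  case one
  then show ?case using orthogonal_matrix_id by (simp add: mat_def)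
next
  case (incl h)
  have gens: "h = Rx (pi / 2) \<or> h = Ry (pi / 2) \<or> h = Rz (2 * pi)"
    using incl by (auto simp: numeral_eq_Suc)
  have "orthogonal_matrix h"
    using gens R_in_SO3 by (auto simp: carrier_SO3 rotation_matrix_def)
  then show ?case using gens by (auto simp: Rx_def Ry_def Rz_def forall_3 vector_3)
next
  case (inv h)
  have gens: "h = Rx (pi / 2) \<or> h = Ry (pi / 2) \<or> h = Rz (2 * pi)"
    using inv by auto
  then have h: "h \<in> carrier SO3" using R_in_SO3 by auto
  then have "orthogonal_matrix (transpose h)"
    by (auto simp: carrier_SO3 rotation_matrix_def orthogonal_matrix_transpose)
  moreover have "\<forall>i j. transpose h $ i $ j \<in> \<int>"
    using gens by (elim disjE) (simp_all add: Rx_def Ry_def Rz_def forall_3 vector_3 transpose_def)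
  ultimately show ?case by (simp add: inv_SO3[OF h])
next
  case (eng h1 h2)
  then show ?case
    using orthogonal_matrix_mul[of h1 h2] by (auto simp: matrix_matrix_mult_def intro!: Ints_sum)
qed

lemma H_subset_integral:
  assumes "unital_subring B"
  shows "H m \<subseteq> integral_in B"
  using G_4_integer subring_of_int[OF assms] unfolding H_def integral_in_def
  by (auto elim!: Ints_cases) (metis Ints_cases)+

text \<open>The divisibility condition excludes exactly the multiples of a quarter turn, that is,
  the angles \<open>t\<close> with \<open>sin (2 * t) = 0\<close>. One ring serves all exponents
  \<open>a\<close> at once.\<close>

lemma exists_tilting_ring:
  assumes "m > 0"
  obtains B where "valuation_subring B" "\<And>a. \<not> int m dvd 4 * a \<Longrightarrow> tilting B (2 * pi * of_int a / m)"
proof -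
  obtain B :: "real set" where B: "valuation_subring B"
    "\<And>t n. \<lbrakk>n > 0; sin (2 * t) \<noteq> 0; cis (t * real n) = 1\<rbrakk> \<Longrightarrow>
      cos t \<notin> B \<and> sin t \<notin> B \<and> cos t / sin t \<in> B \<and> sin t / cos t \<in> B"
    using exists_dyadic_valuation_real by blast
  show ?thesis
  proof (rule that[OF B(1)])
    fix a assume a: "\<not> int m dvd 4 * a"
    define t where "t = 2 * pi * of_int a / m"
    have "sin (2 * t) \<noteq> 0"
    proof
      assume "sin (2 * t) = 0"
      then obtain i :: int where "2 * t = of_int i * pi" by (auto simp: sin_zero_iff_int2)
      then have "of_int (4 * a) = (of_int (i * int m) :: real)" using assms by (simp add: t_def field_simps)
      then have "4 * a = i * int m" by (simp only: of_int_eq_iff)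
      then show False using a by simp
    qed
    moreover have "cis (t * real m) = 1"
      using assms by (simp add: t_def)
    ultimately show "tilting B (2 * pi * of_int a / m)"
      using B(2)[of m t] assms by (simp add: tilting_def t_def)
  qed
qed

section \<open>Differences of exponents that are multiples of a quarter turn\<close>

lemma half_period_dvd:
  assumes "int m dvd 4 * a"
  shows "half_period m dvd 2 * a"
proof (cases "even m")
  case True
  then obtain k where "m = 2 * k" by blast
  then show ?thesis using assms by (auto simp: half_period_def)
next
  case False
  then have "coprime (int m) 2" by simp
  then have "int m dvd 2 * a"
    using assms coprime_dvd_mult_right_iff[of "int m" 2 "2 * a"] by simp
  then show ?thesis using False by (simp add: half_period_def)
qed

lemma admissible_not_dvd: "admissible m a \<Longrightarrow> \<not> int m dvd 4 * a"
  using half_period_dvd[of m a] dvd_imp_le_int[of "2 * a" "half_period m"]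
  by (auto simp: admissible_def abs_mult)

text \<open>\<open>2 * (a - b)\<close> is a nonzero multiple of the half period of absolute value
  below twice the half period, hence plus or minus the half period. For odd \<open>m\<close> parity
  forbids this.\<close>

lemma admissible_diff_dvd:
  assumes "admissible m a" "admissible m b" "a \<noteq> b" "int m dvd 4 * (a - b)"
  shows "4 dvd m" "\<bar>a - b\<bar> = int m div 4"
proof -
  obtain k where k: "2 * (a - b) = half_period m * k" using half_period_dvd[OF assms(4)] by blast
  have "\<bar>2 * (a - b)\<bar> < half_period m * 2" using assms by (auto simp: admissible_def)
  moreover have pos: "half_period m > 0" using assms(1) by (auto simp: admissible_def)
  then have "\<bar>2 * (a - b)\<bar> = half_period m * \<bar>k\<bar>" unfolding k by (simp add: abs_mult)
  ultimately have "half_period m * \<bar>k\<bar> < half_period m * 2" by simp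
  then have "\<bar>k\<bar> < 2" using pos by (simp add: mult_less_cancel_left)
  moreover have "k \<noteq> 0" using k assms by auto
  ultimately have "k = 1 \<or> k = -1" by linarith
  then have *: "2 * \<bar>a - b\<bar> = half_period m" using k pos by auto
  have "even m"
  proof (rule ccontr)
    assume "odd m"
    then have "2 * \<bar>a - b\<bar> = int m" using * by (simp add: half_period_def)
    then show False using \<open>odd m\<close> by presburger
  qed
  then have "int m = 4 * \<bar>a - b\<bar>" using * by (auto simp: half_period_def)
  then show "4 dvd m" "\<bar>a - b\<bar> = int m div 4" by presburger+
qed

text \<open>The last syllable acts on the integral matrix \<open>E\<close>, every earlier one on a
  steep matrix.\<close>

lemma steep_word:
  assumes B: "valuation_subring B" "\<And>a. \<not> int m dvd 4 * a \<Longrightarrow> tilting B (2 * pi * of_int a / m)"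
    and "normal_word m as" "as \<noteq> []" "E \<in> integral_in B"
  shows "steep B (ST_word m as ** E)"
  using assms(3,4)
proof (induction as)
  case (Cons a as)
  have "normal_word m as" "admissible m a" using Cons.prems by (auto simp: normal_word_def)
  then have "ST_word m as ** E \<in> integral_in B \<or> steep B (ST_word m as ** E)"
    using Cons.IH assms(5) by (cases as) (auto simp: ST_word_simps simp del: ST_word.simps)
  then show ?case
    using steep_S_Rx[OF B(1) _ B(2)[OF admissible_not_dvd[OF \<open>admissible m a\<close>]]]
    unfolding ST_word_Cons_mult by blast
qed auto

lemma S_cancel: "S ** A = S ** A' \<Longrightarrow> A = A'"
  using S_mult_rows[of A] S_mult_rows[of A'] by (auto simp: vec_eq_iff[of A A'] forall_3)

lemma cos_sin_quarter:
  assumes "\<bar>d\<bar> = int m div 4" "4 dvd m" "m > 0"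
  shows "cos (2 * pi * of_int d / m) = 0" "\<bar>sin (2 * pi * of_int d / m)\<bar> = 1"
proof -
  obtain k where k: "m = 4 * k" using assms by blast
  then have "d = int k \<or> d = - int k" using assms by auto
  then have "2 * pi * of_int d / m = pi / 2 \<or> 2 * pi * of_int d / m = - (pi / 2)"
    using k assms(3) by (auto simp: field_simps)
  then show "cos (2 * pi * of_int d / m) = 0" "\<bar>sin (2 * pi * of_int d / m)\<bar> = 1"
    by (metis cos_minus cos_pi_half sin_minus sin_pi_half abs_1 abs_minus_cancel)+
qed

text \<open>Syllables are peeled off from the left. Once \<open>S\<close> is cancelled, the
  remaining matrices \<open>A\<close> and \<open>A'\<close> differ by a rotation about the x-axis,
  which their shapes force to be trivial.\<close>

lemma ST_word_unique:
  assumes "m > 0" and B: "valuation_subring B" "\<And>a. \<not> int m dvd 4 * a \<Longrightarrow> tilting B (2 * pi * of_int a / m)"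
    and E: "E \<in> integral_in B" "F \<in> integral_in B"
    and "normal_word m as" "normal_word m bs" "ST_word m as ** E = ST_word m bs ** F"
  shows "as = bs \<and> E = F"
  using assms(6-)
proof (induction as arbitrary: bs)
  case Nil
  then show ?case
    using steep_word[OF B, of bs F] flat_integral[OF B(1) E(1)] not_steep_flat[OF B(1)] E
    by (cases "bs = []") (auto simp: ST_word_simps simp del: ST_word.simps)
next
  case (Cons a as)
  note [simp del] = ST_word.simps
  define t where "t c = 2 * pi * real_of_int c / m" for c
  show ?case
  proof (cases bs)
    case Nil
    then show ?thesis
      using steep_word[OF B Cons.prems(1) _ E(1)] flat_integral[OF B(1) E(2)] not_steep_flat[OF B(1)] Cons.prems(3)
      by (auto simp: ST_word_simps)
  next
    case (Cons b bs')
    define A A' where "A = ST_word m as ** E" and "A' = ST_word m bs' ** F"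
    have ad: "admissible m a" "admissible m b" "normal_word m as" "normal_word m bs'"
      using Cons.prems Cons by (auto simp: normal_word_def)
    have "as = [] \<and> A \<in> integral_in B \<or> steep B A"
      using steep_word[OF B ad(3) _ E(1)] E by (cases "as = []") (auto simp: A_def ST_word_simps)
    moreover have "bs' = [] \<and> A' \<in> integral_in B \<or> steep B A'"
      using steep_word[OF B ad(4) _ E(2)] E by (cases "bs' = []") (auto simp: A'_def ST_word_simps)
    ultimately have cases: "as = [] \<and> A \<in> integral_in B \<or> steep B A" "bs' = [] \<and> A' \<in> integral_in B \<or> steep B A'"
      by this+
    have "Rx (t a) ** A = Rx (t b) ** A'"
      using Cons.prems(3)[unfolded Cons ST_word_Cons_mult] unfolding A_def A'_def t_def by (rule S_cancel)
    then have "Rx (- t b) ** (Rx (t a) ** A) = Rx (- t b) ** (Rx (t b) ** A')" by simp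
    then have eq: "Rx (t (a - b)) ** A = A'"
      by (simp add: matrix_mul_assoc Rx_add Rx_0 t_def diff_divide_distrib right_diff_distrib)
    have "a = b"
    proof (rule ccontr)
      assume "a \<noteq> b"
      have "int m dvd 4 * (a - b)"
      proof (rule ccontr)
        assume "\<not> int m dvd 4 * (a - b)"
        then have "tilting B (t (a - b))" unfolding t_def by (rule B(2))
        then show False
          using not_steep_Rx[OF B(1), of A] cases eq flat_integral[OF B(1)] by auto
      qed
      note quarter = admissible_diff_dvd[OF ad(1,2) \<open>a \<noteq> b\<close> this]
      \<comment> \<open>If both tails were empty, \<open>a\<close> and \<open>b\<close> would be
        last exponents, strictly between 0 and \<open>m / 4\<close>, and could not differ by
        \<open>m / 4\<close>.\<close>
      have "\<not> (as = [] \<and> bs' = [])"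
        using quarter Cons.prems Cons by (auto simp: normal_word_def admissible_def half_period_def)
      note cs = cos_sin_quarter[OF quarter(2,1) \<open>m > 0\<close>, folded t_def]
      have rows: "A' $ 1 = A $ 1" "A' $ 2 = (- sin (t (a - b))) *s A $ 3" "A' $ 3 = sin (t (a - b)) *s A $ 2"
        unfolding eq[symmetric] Rx_mult_rows by (simp_all add: cs)
      have "sin (t (a - b)) = 1 \<or> sin (t (a - b)) = -1" using cs(2) by linarith
      then have "entry_span B (A' $ 1) = entry_span B (A $ 1)" "entry_span B (A' $ 2) = entry_span B (A $ 3)"
        "entry_span B (A' $ 3) = entry_span B (A $ 2)"
        unfolding rows by (auto simp: entry_span_minus[OF B(1)] vector_sneg_minus1[symmetric])
      \<comment> \<open>Exchanging rows 2 and 3 keeps a flat matrix flat and gives a steep one its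
        small row in position 2.\<close>
      then have "\<not> (steep B A \<and> (steep B A' \<or> flat B A'))" "\<not> (flat B A \<and> steep B A')"
        unfolding steep_def flat_def by (metis psubset_eq)+
      then show False
        using cases \<open>\<not> (as = [] \<and> bs' = [])\<close> flat_integral[OF B(1)] by blast
    qed
    then have "A = A'" using eq by (simp add: t_def Rx_0)
    then show ?thesis
      using Cons.IH[OF ad(3,4)] \<open>a = b\<close> Cons by (simp add: A_def A'_def)
  qed
qed

section \<open>Recovering the prefix \<open>W\<close>\<close>

lemma S_cubed_rows: "(S ** S ** S ** A) $ 1 = - A $ 3" "(S ** S ** S ** A) $ 2 = A $ 2"
  "(S ** S ** S ** A) $ 3 = A $ 1"
  by (simp_all add: S_mult_rows flip: matrix_mul_assoc)

lemma U_rows: "(U ** A) $ 1 = A $ 1" "(U ** A) $ 2 = - A $ 3" "(U ** A) $ 3 = A $ 2"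
  by (simp_all add: U_def Rx_mult_rows)

lemma steep_prefix_unique:
  assumes B: "valuation_subring B" and A: "steep B A" "steep B A'"
    and W: "W \<in> {mat 1, S ** S ** S, U}" "W' \<in> {mat 1, S ** S ** S, U}"
    and eq: "W ** A = W' ** A'"
  shows "W = W'" "\<not> flat B (W ** A)"
proof -
  define low where "low M i \<longleftrightarrow> (\<forall>j. j \<noteq> i \<longrightarrow> entry_span B (M $ i) \<subset> entry_span B (M $ j))"
    for M :: "real^3^3" and i
  have unique: "i = j" if "low M i" "low M j" for M i j
  proof (rule ccontr)
    assume "i \<noteq> j"
    then have "entry_span B (M $ i) \<subset> entry_span B (M $ j)" "entry_span B (M $ j) \<subset> entry_span B (M $ i)"
      using that by (auto simp: low_def)
    then show False by blast
  qed
  have low: "low (mat 1 ** M) 3" "low (S ** S ** S ** M) 1" "low (U ** M) 2" if "steep B M" for M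
    using that by (auto simp: low_def steep_def forall_3 S_cubed_rows U_rows entry_span_minus[OF B])
  show "W = W'"
  proof -
    \<comment> \<open>Where each prefix puts the small third row; the default 1 belongs to
      \<open>S ** S ** S\<close>.\<close>
    define pos where "pos V = (if V = mat 1 then 3 else if V = U then 2 else 1 :: 3)" for V
    have "low (W ** A) (pos W)" using W(1) low[OF A(1)] by (auto simp: pos_def)
    moreover have "low (W ** A) (pos W')" unfolding eq using W(2) low[OF A(2)] by (auto simp: pos_def)
    ultimately have "pos W = pos W'" by (rule unique)
    then show ?thesis using W by (auto simp: pos_def split: if_splits)
  qed
  have "\<exists>i. low (W ** A) i" using W(1) low[OF A(1)] by auto
  then show "\<not> flat B (W ** A)"
    unfolding low_def flat_def by (metis psubset_eq zero_neq_one)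
qed

lemma normal_form_unique:
  assumes "m > 0"
    and W: "W \<in> {mat 1, S ** S ** S} \<or> 4 dvd m \<and> W = U" "as = [] \<longrightarrow> W = mat 1" "normal_word m as" "E \<in> H m"
    and W': "W' \<in> {mat 1, S ** S ** S} \<or> 4 dvd m \<and> W' = U" "bs = [] \<longrightarrow> W' = mat 1" "normal_word m bs" "F \<in> H m"
    and eq: "W ** ST_word m as ** E = W' ** ST_word m bs ** F"
  shows "W = W' \<and> as = bs \<and> E = F"
proof -
  obtain B where B: "valuation_subring B" "\<And>a. \<not> int m dvd 4 * a \<Longrightarrow> tilting B (2 * pi * of_int a / m)"
    using exists_tilting_ring[OF assms(1)] by blast
  have EF: "E \<in> integral_in B" "F \<in> integral_in B"
    using H_subset_integral[OF val_subring[OF B(1)]] W W' by blast+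
  have eq: "W ** (ST_word m as ** E) = W' ** (ST_word m bs ** F)"
    using eq by (simp add: matrix_mul_assoc)
  note steep = steep_word[OF B W(3) _ EF(1)] steep_word[OF B W'(3) _ EF(2)]
  note flat = flat_integral[OF B(1) EF(1)] flat_integral[OF B(1) EF(2)]
  have Ws: "W \<in> {mat 1, S ** S ** S, U}" "W' \<in> {mat 1, S ** S ** S, U}" using W(1) W'(1) by auto
  note prefix = steep_prefix_unique[OF B(1)]
  have "W = W'"
  \<comment> \<open>A nonempty word stays non-flat behind any prefix, whereas an empty one leaves a
    flat matrix. Hence both words are empty or neither is.\<close>
  proof (cases "as = [] \<or> bs = []")
    case True
    then have "as = [] \<and> bs = []"
      using prefix(2)[OF steep(1) steep(1) Ws(1) Ws(1) refl] prefix(2)[OF steep(2) steep(2) Ws(2) Ws(2) refl]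
        eq W(2) W'(2) flat by (cases "as = []"; cases "bs = []") (auto simp: ST_word_simps simp del: ST_word.simps)
    then show ?thesis using W(2) W'(2) by simp
  next
    case False
    then show ?thesis using prefix(1)[OF steep Ws eq] by simp
  qed
  moreover have "transpose W' ** W' = mat 1"
  proof -
    have "W' \<in> carrier SO3"
      using Ws(2) R_in_SO3 group_SO3 unfolding S_def U_def by (auto simp: carrier_SO3 orthogonal_matrix_mul rotation_matrix_def orthogonal_matrix_id det_mul)
    then show ?thesis by (simp add: carrier_SO3 rotation_matrix_def orthogonal_matrix_def)
  qed
  ultimately have "ST_word m as ** E = ST_word m bs ** F"
    using arg_cong[OF eq, of "(**) (transpose W')"] by (simp add: matrix_mul_assoc)
  then show ?thesis
    using ST_word_unique[OF assms(1) B EF W(3) W'(3)] \<open>W = W'\<close> by blast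
qed

subsection \<open>Existence\<close>

lemma subgroup_G: "subgroup (G p l q) SO3"
  unfolding G_def using R_in_SO3 by (intro group.generate_is_subgroup[OF group_SO3]) auto

lemma subgroup_H: "subgroup (H m) SO3"
  unfolding H_def by (intro group.subgroups_Inter_pair[OF group_SO3] subgroup_G)

lemma H_mult: "A \<in> H m \<Longrightarrow> B \<in> H m \<Longrightarrow> A ** B \<in> H m"
  using subgroup.m_closed[OF subgroup_H] by simp

lemma H_one: "mat 1 \<in> H m"
  using subgroup.one_closed[OF subgroup_H] by simp

lemma Rx_in_G:
  assumes "p > 0"
  shows "Rx (2 * pi * of_int k / p) \<in> G p l q"
proof -
  have "Rx (2 * pi / p) \<in> G p l q"
    unfolding G_def by (rule generate.incl) simp
  then have "Rx (2 * pi / p) [^]\<^bsub>SO3\<^esub> k \<in> G p l q"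
    by (rule group.subgroup_int_pow_closed[OF group_SO3 subgroup_G])
  then show ?thesis by (simp add: Rx_int_pow mult_ac)
qed

lemma S_in_H: "S \<in> H m"
  unfolding H_def G_def S_def by (auto intro: generate.incl)

text \<open>The equation says that \<open>k\<close> quarter turns and \<open>j\<close> steps of
  \<open>T m\<close> make the same angle, so the rotation lies in both groups.\<close>

lemma Rx_in_H:
  assumes "m > 0" "k * int m = 4 * j"
  shows "Rx (pi / 2 * of_int k) \<in> H m"
proof -
  have "of_int (k * int m) = (of_int (4 * j) :: real)" using assms by (simp only:)
  then have "of_int k * real m = 4 * real_of_int j" by simp
  then have "pi / 2 * of_int k = 2 * pi * of_int j / m"
    using assms by (simp add: field_simps)
  then show ?thesis
    using Rx_in_G[of m j 4 1] Rx_in_G[of 4 k 4 1] assms by (simp add: H_def mult_ac)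
qed

lemma U_in_H:
  assumes "m > 0" "4 dvd m"
  shows "U \<in> H m"
proof -
  obtain k where "m = 4 * k" using assms by blast
  then show ?thesis using Rx_in_H[of m 1 "int k"] assms by (simp add: U_def)
qed

text \<open>For even \<open>m\<close> the Klein four-group of half turns about the axes, otherwise
  its subgroup generated by \<open>Ry pi\<close>. These are the elements of \<open>H m\<close> that
  get pushed through words.\<close>

definition klein :: "nat \<Rightarrow> (real^3^3) set" where
  "klein m = (if even m then {mat 1, Rx pi, Ry pi, Rz pi} else {mat 1, Ry pi})"

lemma klein_products: "S ** S = Ry pi" "Rx pi ** Ry pi = Rz pi"
  by (simp_all add: matrix3_simps Rz_def S_def)

lemma klein_subset_H:
  assumes "m > 0"
  shows "klein m \<subseteq> H m"
proof -
  have y: "Ry pi \<in> H m" using H_mult[OF S_in_H S_in_H] by (simp add: klein_products)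
  have x: "Rx pi \<in> H m" if "even m"
  proof -
    obtain k where "m = 2 * k" using \<open>even m\<close> by blast
    then show ?thesis using Rx_in_H[of m 2 "int k"] assms by simp
  qed
  then have z: "Rz pi \<in> H m" if "even m" using that H_mult[OF x y] by (simp add: klein_products)
  show ?thesis using x y z H_one by (auto simp: klein_def)
qed

lemma klein_S: "k \<in> klein m \<Longrightarrow> \<exists>k'\<in>klein m. k ** S = S ** k'"
proof -
  have "Rx pi ** S = S ** Rz pi" "Rz pi ** S = S ** Rx pi" "Ry pi ** S = S ** Ry pi"
    by (simp_all add: matrix3_simps Rz_def S_def)
  then show "k \<in> klein m \<Longrightarrow> ?thesis" by (auto simp: klein_def split: if_splits)
qed

text \<open>Half turns about y and z invert rotations about x, the one about x commutes with them.
  The sign \<open>e\<close> is the same for all angles.\<close>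

lemma klein_Rx: "k \<in> klein m \<Longrightarrow> \<exists>e\<in>{1, -1 :: int}. \<forall>t. k ** Rx t = Rx (of_int e * t) ** k"
proof -
  have "Rx pi ** Rx t = Rx t ** Rx pi" "Rz pi ** Rx t = Rx (- t) ** Rz pi" "Ry pi ** Rx t = Rx (- t) ** Ry pi" for t
    by (simp_all add: matrix3_simps Rz_def)
  then show "k \<in> klein m \<Longrightarrow> ?thesis" by (auto simp: klein_def split: if_splits)
qed

text \<open>The sign of the last exponent is left free, since a half turn passing through may flip
  it.\<close>

abbreviation admissible_word :: "nat \<Rightarrow> int list \<Rightarrow> bool" where
  "admissible_word m as \<equiv> \<forall>a\<in>set as. admissible m a"

lemma klein_word:
  assumes "admissible_word m as" "k \<in> klein m"
  shows "\<exists>bs. \<exists>k'\<in>klein m. admissible_word m bs \<and> k ** ST_word m as = ST_word m bs ** k'"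
  using assms
proof (induction as arbitrary: k)
  case Nil
  then show ?case by (intro exI[of _ "[]"] bexI[of _ k]) (auto simp: ST_word_simps simp del: ST_word.simps)
next
  case (Cons a as)
  obtain k' where k': "k' \<in> klein m" "k ** S = S ** k'" using klein_S Cons.prems by blast
  obtain e where e: "e \<in> {1, -1 :: int}" "\<And>t. k' ** Rx t = Rx (of_int e * t) ** k'" using klein_Rx k' by blast
  obtain bs k'' where bs: "k'' \<in> klein m" "admissible_word m bs" "k' ** ST_word m as = ST_word m bs ** k''"
    using Cons.IH[OF _ k'(1)] Cons.prems(1) by (metis list.set_intros(2))
  have "k ** ST_word m (a # as) = S ** (Rx (of_int e * (2 * pi * a / m)) ** (k' ** ST_word m as))"
    unfolding ST_word_simps by (simp only: matrix_mul_assoc k'(2)) (simp only: e(2) flip: matrix_mul_assoc)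
  also have "\<dots> = ST_word m ((e * a) # bs) ** k''"
    unfolding bs ST_word_Cons_mult by (simp add: mult_ac)
  finally show ?case
    using bs e Cons.prems by (intro exI[of _ "(e * a) # bs"] bexI[of _ k'']) (auto simp: admissible_def)
qed

section \<open>Reduction of exponents modulo the half period\<close>

lemma Rx_2pi_int: "Rx (2 * pi * of_int k) = mat 1"
  by (simp add: matrix3_simps)

lemma half_period_pos: "m > 0 \<Longrightarrow> half_period m > 0"
  unfolding half_period_def by presburger

lemma Rx_half_period:
  assumes "m > 0"
  shows "Rx (2 * pi * of_int (half_period m * q) / m) \<in> klein m"
proof (cases "even m")
  case True
  then obtain k where k: "m = 2 * k" by blast
  then have "2 * pi * of_int (half_period m * q) / m = pi * of_int q"
    using assms by (simp add: half_period_def)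
  moreover have "Rx (pi * of_int q) \<in> {mat 1, Rx pi}"
  proof (cases "even q")
    case True
    then obtain r where "q = 2 * r" by blast
    then have "pi * of_int q = 2 * pi * of_int r" by simp
    then show ?thesis by (simp only: Rx_2pi_int insert_iff simp_thms)
  next
    case False
    then obtain r where r: "q = 2 * r + 1" by (blast elim: oddE)
    then have "pi * of_int q = 2 * pi * of_int r + pi" by (simp add: algebra_simps)
    then have "cos (pi * of_int q) = -1 \<and> sin (pi * of_int q) = 0" by (simp add: cos_add sin_add)
    then show ?thesis by (simp add: Rx_def)
  qed
  ultimately show ?thesis using True by (auto simp: klein_def)
next
  case False
  then have "2 * pi * of_int (half_period m * q) / m = 2 * pi * of_int q"
    using assms by (simp add: half_period_def)
  then show ?thesis using False by (simp add: klein_def Rx_2pi_int)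
qed

lemma symmetric_residue:
  assumes "(h :: int) > 0"
  obtains a q where "k = a + h * q" "- h < 2 * a" "2 * a \<le> h"
proof -
  define r where "r = k mod h"
  have r: "0 \<le> r" "r < h" "k = r + h * (k div h)" using assms by (simp_all add: r_def)
  show ?thesis
  proof (cases "2 * r \<le> h")
    case True
    then show ?thesis using r that[of r "k div h"] assms by auto
  next
    case False
    then show ?thesis using r that[of "r - h" "k div h + 1"] assms by (auto simp: algebra_simps)
  qed
qed

text \<open>The closed end \<open>2 * a = half_period m\<close> of the residue range is reached only
  if 4 divides \<open>m\<close>. It is the quarter turn \<open>U\<close>, which is why
  \<open>U\<close> occurs as a prefix.\<close>

lemma residue_cases:
  assumes "m > 0"
  obtains a q where "k = a + half_period m * q" "a = 0 \<or> admissible m a \<or> (4 dvd m \<and> a = int m div 4)"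
proof -
  obtain a q where aq: "k = a + half_period m * q" "- half_period m < 2 * a" "2 * a \<le> half_period m"
    using symmetric_residue[OF half_period_pos[OF assms]] by blast
  show ?thesis
  proof (cases "2 * a = half_period m")
    case True
    then have "4 dvd m \<and> a = int m div 4"
      unfolding half_period_def by (cases "even m") (auto, presburger+)
    then show ?thesis using that aq by blast
  next
    case False
    then have "a = 0 \<or> admissible m a" using aq by (auto simp: admissible_def)
    then show ?thesis using that aq by blast
  qed
qed

lemma Rx_quarter: "m > 0 \<Longrightarrow> 4 dvd m \<Longrightarrow> Rx (2 * pi * of_int (int m div 4) / m) = U"
  unfolding U_def by (auto simp: field_simps)

text \<open>The normal form without the sign condition on the last exponent and without the
  condition on \<open>W\<close> for empty words, so that left multiplication by generators preserves
  it.\<close>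

definition weak_form :: "nat \<Rightarrow> real^3^3 \<Rightarrow> bool" where
  "weak_form m g \<longleftrightarrow> (\<exists>W as E. (W \<in> {mat 1, S ** S ** S} \<or> 4 dvd m \<and> W = U) \<and> admissible_word m as \<and>
     E \<in> H m \<and> g = W ** (ST_word m as ** E))"

lemma weak_formI:
  assumes "W \<in> {mat 1, S ** S ** S} \<or> 4 dvd m \<and> W = U" "admissible_word m as" "E \<in> H m"
  shows "weak_form m (W ** (ST_word m as ** E))"
  using assms unfolding weak_form_def by blast

lemma S_4: "S ** (S ** (S ** S)) = mat 1"
  by (simp add: matrix3_simps S_def)

text \<open>The multiple of the half period in \<open>k\<close> is a half turn or trivial and moves
  through the word into \<open>E\<close>. The remainder vanishes, becomes a new first syllable, or
  becomes the prefix \<open>U\<close>.\<close>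

lemma weak_form_Rx_word:
  assumes "m > 0" "admissible_word m as" "E \<in> H m"
  shows "weak_form m (Rx (2 * pi * of_int k / m) ** (ST_word m as ** E))"
proof -
  obtain a q where aq: "k = a + half_period m * q" "a = 0 \<or> admissible m a \<or> (4 dvd m \<and> a = int m div 4)"
    using residue_cases[OF assms(1)] by blast
  define \<kappa> where "\<kappa> = Rx (2 * pi * of_int (half_period m * q) / m)"
  obtain bs k' where bs: "admissible_word m bs" "k' \<in> klein m" "\<kappa> ** ST_word m as = ST_word m bs ** k'"
    using klein_word[OF assms(2) Rx_half_period[OF assms(1)], of q] unfolding \<kappa>_def by blast
  define F where "F = k' ** E"
  have F: "F \<in> H m" unfolding F_def using bs klein_subset_H[OF assms(1)] assms H_mult by blast
  have split: "Rx (2 * pi * of_int k / m) = Rx (2 * pi * of_int a / m) ** \<kappa>"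
    unfolding \<kappa>_def Rx_add aq(1) by (simp add: algebra_simps add_divide_distrib)
  have "Rx (2 * pi * of_int k / m) ** (ST_word m as ** E) = Rx (2 * pi * of_int a / m) ** ((\<kappa> ** ST_word m as) ** E)"
    unfolding split by (simp only: matrix_mul_assoc)
  also have "\<dots> = Rx (2 * pi * of_int a / m) ** (ST_word m bs ** F)"
    unfolding bs F_def by (simp only: matrix_mul_assoc)
  finally have eq: "Rx (2 * pi * of_int k / m) ** (ST_word m as ** E) = Rx (2 * pi * of_int a / m) ** (ST_word m bs ** F)" .
  from aq(2) consider "a = 0" | "admissible m a" | "4 dvd m" "a = int m div 4" by blast
  then show ?thesis
  proof cases
    case 1
    then show ?thesis using weak_formI[of "mat 1" m bs F] bs F by (simp add: eq Rx_0)
  next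
    case 2
    \<comment> \<open>The identity is inserted as the fourth power of \<open>S\<close>: one factor
      starts the new syllable, three form the prefix.\<close>
    have "Rx (2 * pi * of_int a / m) ** (ST_word m bs ** F) =
        (S ** (S ** (S ** S))) ** (Rx (2 * pi * of_int a / m) ** (ST_word m bs ** F))"
      by (simp add: S_4)
    also have "\<dots> = (S ** S ** S) ** (ST_word m (a # bs) ** F)"
      unfolding ST_word_Cons_mult by (simp only: matrix_mul_assoc)
    finally show ?thesis using weak_formI[of "S ** S ** S" m "a # bs" F] bs F 2 by (simp add: eq)
  next
    case 3
    then show ?thesis using weak_formI[of U m bs F] bs F by (simp add: eq Rx_quarter[OF assms(1)])
  qed
qed

text \<open>Every prefix is removed first: \<open>S ** S ** S\<close> cancels the \<open>S\<close>
  of the first syllable, or joins \<open>E\<close> if there is none, and \<open>U\<close> counts as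
  \<open>m / 4\<close> further steps.\<close>

lemma weak_form_Rx:
  assumes "m > 0" "weak_form m g"
  shows "weak_form m (Rx (2 * pi * of_int k / m) ** g)"
proof -
  obtain W as E where g: "W \<in> {mat 1, S ** S ** S} \<or> 4 dvd m \<and> W = U" "admissible_word m as"
    "E \<in> H m" "g = W ** (ST_word m as ** E)" using assms by (auto simp: weak_form_def)
  note word = weak_form_Rx_word[OF assms(1) _ g(3)]
  have add: "Rx (2 * pi * of_int k / m) ** Rx (2 * pi * of_int j / m) = Rx (2 * pi * of_int (k + j) / m)" for j
    unfolding Rx_add by (simp add: algebra_simps add_divide_distrib)
  consider "W = mat 1" | "W = S ** S ** S" "as = []" | a as' where "W = S ** S ** S" "as = a # as'" | "W = U" "4 dvd m"
    using g(1) by (cases as) auto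
  then show ?thesis
  proof cases
    case 1
    then show ?thesis using word[OF g(2)] by (simp add: g)
  next
    case 2
    have "S ** S ** S ** E \<in> H m" using S_in_H g H_mult by blast
    then show ?thesis using weak_form_Rx_word[OF assms(1), of "[]" "S ** S ** S ** E" k] 2
      by (simp add: g ST_word_simps del: ST_word.simps)
  next
    case 3
    have "g = (S ** (S ** (S ** S))) ** (Rx (2 * pi * of_int a / m) ** (ST_word m as' ** E))"
      unfolding g 3 ST_word_Cons_mult by (simp only: matrix_mul_assoc)
    then have "Rx (2 * pi * of_int k / m) ** g = Rx (2 * pi * of_int (k + a) / m) ** (ST_word m as' ** E)"
      unfolding S_4 add[symmetric] by (simp add: matrix_mul_assoc)
    then show ?thesis using word[of as' "k + a"] g(2) 3 by simp
  next
    case 4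
    have "Rx (2 * pi * of_int k / m) ** g = Rx (2 * pi * of_int (k + int m div 4) / m) ** (ST_word m as ** E)"
      unfolding g add[symmetric] 4 Rx_quarter[OF assms(1) 4(2)] by (simp only: matrix_mul_assoc)
    then show ?thesis using word[OF g(2), of "k + int m div 4"] by (simp only:)
  qed
qed

text \<open>A braid relation between quarter turns about two perpendicular axes.\<close>

lemma S_U_S: "S ** (U ** S) = U ** (S ** U)"
  by (simp add: matrix3_simps S_def U_def)

lemma weak_form_S:
  assumes "m > 0" "weak_form m g"
  shows "weak_form m (S ** g)"
proof -
  obtain W as E where g: "W \<in> {mat 1, S ** S ** S} \<or> 4 dvd m \<and> W = U" "admissible_word m as"
    "E \<in> H m" "g = W ** (ST_word m as ** E)" using assms by (auto simp: weak_form_def)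
  consider "W = mat 1" | "W = S ** S ** S" | "W = U" "4 dvd m" "as = []" | a as' where "W = U" "4 dvd m" "as = a # as'"
    using g(1) by (cases as) auto
  then show ?thesis
  proof cases
    case 1
    have "Ry pi \<in> klein m" by (simp add: klein_def)
    then obtain bs k where bs: "k \<in> klein m" "admissible_word m bs" "Ry pi ** ST_word m as = ST_word m bs ** k"
      using klein_word[OF g(2)] by blast
    \<comment> \<open>\<open>S\<close> is rewritten as its cube times the half turn
      \<open>S ** S\<close>, which then moves through the word.\<close>
    have "S ** g = S ** ((S ** (S ** (S ** S))) ** (ST_word m as ** E))"
      by (simp add: g 1 S_4)
    also have "\<dots> = (S ** S ** S) ** (((S ** S) ** ST_word m as) ** E)"
      by (simp only: matrix_mul_assoc)
    also have "\<dots> = (S ** S ** S) ** (ST_word m bs ** (k ** E))"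
      unfolding klein_products(1) bs by (simp only: matrix_mul_assoc)
    finally show ?thesis
      using weak_formI[of "S ** S ** S" m bs "k ** E"] bs g klein_subset_H[OF assms(1)] H_mult by auto
  next
    case 2
    have "S ** g = (S ** (S ** (S ** S))) ** (ST_word m as ** E)"
      unfolding g 2 by (simp only: matrix_mul_assoc)
    then show ?thesis using weak_formI[of "mat 1" m as E] g by (simp add: S_4)
  next
    case 3
    have "S ** U ** E \<in> H m" using S_in_H U_in_H[OF assms(1) 3(2)] g H_mult by blast
    then show ?thesis using weak_formI[of "mat 1" m "[]" "S ** U ** E"] 3
      by (simp add: g ST_word_simps matrix_mul_assoc del: ST_word.simps)
  next
    case 4
    \<comment> \<open>By the braid relation the prefix \<open>U\<close> survives in front, and
      another \<open>U\<close> merges with the first exponent, adding \<open>m / 4\<close> to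
      it.\<close>
    define k where "k = int m div 4 + a"
    obtain b q where bq: "k = b + half_period m * q" "b = 0 \<or> admissible m b \<or> (4 dvd m \<and> b = int m div 4)"
      using residue_cases[OF assms(1)] by blast
    obtain n where n: "m = 4 * n" using 4 by blast
    then have hp: "half_period m = 2 * int n" "int m div 4 = int n" by (auto simp: half_period_def)
    have a: "a \<noteq> 0" "\<bar>a\<bar> < int n" using 4 g(2) by (auto simp: admissible_def hp)
    \<comment> \<open>Reduced exponents 0 and \<open>m / 4\<close> would each make
      \<open>m / 4\<close> divide \<open>a\<close>, but \<open>a\<close> is nonzero and smaller than
      that in absolute value.\<close>
    have "b \<noteq> 0"
    proof
      assume "b = 0"
      then have "a = int n * (2 * q - 1)" using bq(1) by (simp add: k_def hp algebra_simps)
      then have "int n dvd a" by simp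
      then show False using a dvd_imp_le_int[of a "int n"] by auto
    qed
    moreover have "b \<noteq> int m div 4"
    proof
      assume "b = int m div 4"
      then have "a = int n * (2 * q)" using bq(1) by (simp add: k_def hp)
      then have "int n dvd a" by simp
      then show False using a dvd_imp_le_int[of a "int n"] by auto
    qed
    ultimately have b: "admissible m b" using bq by auto
    define \<kappa> where "\<kappa> = Rx (2 * pi * of_int (half_period m * q) / m)"
    obtain bs k' where bs: "admissible_word m bs" "k' \<in> klein m" "\<kappa> ** ST_word m as' = ST_word m bs ** k'"
      using klein_word[OF _ Rx_half_period[OF assms(1)], of as' q] g(2) 4 unfolding \<kappa>_def by auto
    have split: "U ** Rx (2 * pi * of_int a / m) = Rx (2 * pi * of_int b / m) ** \<kappa>"
      unfolding \<kappa>_def Rx_quarter[OF assms(1) 4(2), symmetric] Rx_add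
      using arg_cong[OF bq(1), of "\<lambda>z. 2 * pi * real_of_int z / m"]
      by (simp add: k_def distrib_left add_divide_distrib)
    have "S ** g = (S ** (U ** S)) ** (Rx (2 * pi * of_int a / m) ** (ST_word m as' ** E))"
      unfolding g 4 ST_word_Cons_mult by (simp only: matrix_mul_assoc)
    also have "\<dots> = U ** (S ** ((U ** Rx (2 * pi * of_int a / m)) ** (ST_word m as' ** E)))"
      unfolding S_U_S by (simp only: matrix_mul_assoc)
    also have "\<dots> = U ** (S ** (Rx (2 * pi * of_int b / m) ** ((\<kappa> ** ST_word m as') ** E)))"
      unfolding split by (simp only: matrix_mul_assoc)
    also have "\<dots> = U ** (ST_word m (b # bs) ** (k' ** E))"
      unfolding bs ST_word_Cons_mult by (simp only: matrix_mul_assoc)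
    finally show ?thesis
      using weak_formI[of U m "b # bs" "k' ** E"] b bs g klein_subset_H[OF assms(1)] H_mult 4 by auto
  qed
qed

lemma weak_form_G:
  assumes "m > 0" "g \<in> G m 4 1"
  shows "weak_form m g"
proof -
  have S3: "inv\<^bsub>SO3\<^esub> S = S ** (S ** S)"
  proof (rule group.inv_equality[OF group_SO3])
    show "S \<in> carrier SO3" "S ** (S ** S) \<in> carrier SO3"
      using S_in_H H_mult subgroup.subset[OF subgroup_H] by blast+
  qed (simp add: S_4 flip: matrix_mul_assoc)
  have Rz: "Rz (2 * pi) = mat 1" by (simp add: matrix3_simps Rz_def)
  \<comment> \<open>Quantifying over \<open>x\<close> makes the induction pass through products. The
    inverse of \<open>S\<close> is its cube, so \<open>weak_form_S\<close> is applied three times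
    for it.\<close>
  have gen: "weak_form m (g ** x)" if "weak_form m x" for x
    using assms(2) that unfolding G_def
  proof (induction arbitrary: x rule: generate.induct)
    case one
    then show ?case by simp
  next
    case (incl h)
    then have "h = Rx (2 * pi * of_int 1 / m) \<or> h = S \<or> h = mat 1" by (auto simp: S_def Rz)
    then show ?case
      using weak_form_Rx[OF assms(1) incl(2), of 1] weak_form_S[OF assms(1) incl(2)] incl(2) by auto
  next
    case (inv h)
    then have "h = Rx (2 * pi * of_int 1 / m) \<or> h = S \<or> h = mat 1" by (auto simp: S_def Rz)
    then show ?case
    proof (elim disjE)
      assume "h = Rx (2 * pi * of_int 1 / m)"
      then have "inv\<^bsub>SO3\<^esub> h = Rx (2 * pi * of_int (-1) / m)"
        using R_in_SO3 by (simp add: inv_SO3 transpose_Rx)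
      then show ?thesis using weak_form_Rx[OF assms(1) inv(2), of "-1"] by simp
    next
      assume "h = S"
      then show ?thesis
        using weak_form_S[OF assms(1) weak_form_S[OF assms(1) weak_form_S[OF assms(1) inv(2)]]]
        by (simp add: S3 matrix_mul_assoc)
    next
      assume "h = mat 1"
      then show ?thesis using inv(2) monoid.inv_one[OF group.is_monoid[OF group_SO3]] by simp
    qed
  next
    case (eng h1 h2)
    then show ?case by (simp flip: matrix_mul_assoc)
  qed
  have "weak_form m (mat 1)"
    using weak_formI[of "mat 1" m "[]" "mat 1"] H_one by (simp add: ST_word_simps del: ST_word.simps)
  from gen[OF this] show ?thesis by simp
qed

section \<open>From weak forms to normal forms\<close>

lemma ST_word_snoc: "ST_word m (as @ [a]) = ST_word m as ** (S ** Rx (2 * pi * a / m))"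
  by (induction as) (simp_all add: ST_word_simps matrix_mul_assoc del: ST_word.simps)

lemma normal_form_exists:
  assumes "m > 0" "g \<in> G m 4 1"
  shows "\<exists>W as E. (W \<in> {mat 1, S ** S ** S} \<or> 4 dvd m \<and> W = U) \<and> (as = [] \<longrightarrow> W = mat 1) \<and>
    normal_word m as \<and> W \<in> H m \<and> E \<in> H m \<and> g = W ** ST_word m as ** E"
proof -
  obtain W as E where g: "W \<in> {mat 1, S ** S ** S} \<or> 4 dvd m \<and> W = U" "admissible_word m as"
    "E \<in> H m" "g = W ** (ST_word m as ** E)" using weak_form_G[OF assms] by (auto simp: weak_form_def)
  have W: "W \<in> H m"
    using g(1) H_one S_in_H H_mult U_in_H[OF assms(1)] by auto
  show ?thesis
  proof (cases as rule: rev_cases)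
    case Nil
    then show ?thesis
      using g W H_one H_mult by (intro exI[of _ "mat 1"] exI[of _ "[]"] exI[of _ "W ** E"])
        (auto simp: ST_word_simps normal_word_def simp del: ST_word.simps)
  next
    case (snoc bs a)
    show ?thesis
    proof (cases "4 dvd m \<and> a < 0")
      case False
      then have "normal_word m as" using g snoc by (force simp: normal_word_def admissible_def)
      then show ?thesis
        using g W snoc by (intro exI[of _ W] exI[of _ as] exI[of _ E]) (auto simp: matrix_mul_assoc)
    next
      case True
      \<comment> \<open>A negative last exponent lies above \<open>- m / 4\<close>, so adding
        \<open>m / 4\<close> makes it positive and keeps it admissible. The surplus \<open>U\<close>
        is undone by \<open>transpose U\<close>, which joins \<open>E\<close>.\<close>
      define c where "c = a + int m div 4"
      have "\<bar>a\<bar> < int m div 4" using g snoc True by (auto simp: admissible_def half_period_def)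
      then have c: "admissible m c" "c > 0" using True by (auto simp: admissible_def half_period_def c_def)
      have "Rx (2 * pi * of_int c / m) = Rx (2 * pi * of_int a / m) ** U"
        using True by (simp add: Rx_quarter[OF assms(1), symmetric] Rx_add c_def distrib_left add_divide_distrib)
      moreover have U: "U ** transpose U = mat 1" "transpose U \<in> H m"
      proof -
        have "U \<in> carrier SO3" by (simp add: U_def R_in_SO3)
        then show "U ** transpose U = mat 1" "transpose U \<in> H m"
          using subgroup.m_inv_closed[OF subgroup_H U_in_H[OF assms(1)]] True
          by (auto simp: inv_SO3 carrier_SO3 rotation_matrix_def orthogonal_matrix_def)
      qed
      ultimately have "Rx (2 * pi * of_int c / m) ** transpose U = Rx (2 * pi * of_int a / m)"
        by (simp flip: matrix_mul_assoc)
      then have "ST_word m as ** E = ST_word m (bs @ [c]) ** (transpose U ** E)"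
        unfolding snoc ST_word_snoc by (metis matrix_mul_assoc)
      then show ?thesis
        using g W snoc c U(2) H_mult[OF U(2) g(3)]
        by (intro exI[of _ W] exI[of _ "bs @ [c]"] exI[of _ "transpose U ** E"])
          (auto simp: matrix_mul_assoc normal_word_def)
    qed
  qed
qed

theorem theorem2:
  fixes m :: nat and g :: "real^3^3"
  assumes "m > 0" and "g \<in> G m 4 1"
  shows "\<exists>!x. case x of (n :: nat, W, as :: int list, E) \<Rightarrow>
    length as = n \<and> W \<in> H m \<and> E \<in> H m \<and> restrictions m n W as \<and>
    g = W \<otimes>\<^bsub>SO3\<^esub> ST_word m as \<otimes>\<^bsub>SO3\<^esub> E"
proof -
  obtain W as E where g: "W \<in> {mat 1, S ** S ** S} \<or> 4 dvd m \<and> W = U" "as = [] \<longrightarrow> W = mat 1"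
    "normal_word m as" "E \<in> H m" "W \<in> H m" "g = W ** ST_word m as ** E"
    using normal_form_exists[OF assms] by blast
  show ?thesis
  proof (rule ex1I[of _ "(length as, W, as, E)"])
    show "case (length as, W, as, E) of (n, W, as, E) \<Rightarrow>
      length as = n \<and> W \<in> H m \<and> E \<in> H m \<and> restrictions m n W as \<and>
      g = W \<otimes>\<^bsub>SO3\<^esub> ST_word m as \<otimes>\<^bsub>SO3\<^esub> E"
      using g by (simp add: restrictions_iff[OF assms(1)])
  next
    fix x :: "nat \<times> (real^3^3) \<times> int list \<times> (real^3^3)"
    assume "case x of (n, W, as, E) \<Rightarrow> length as = n \<and> W \<in> H m \<and> E \<in> H m \<and> restrictions m n W as \<and>
      g = W \<otimes>\<^bsub>SO3\<^esub> ST_word m as \<otimes>\<^bsub>SO3\<^esub> E"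
    then obtain W' bs F where x: "x = (length bs, W', bs, F)" "F \<in> H m" "restrictions m (length bs) W' bs"
      "g = W' ** ST_word m bs ** F" by (auto split: prod.splits)
    have "W = W' \<and> as = bs \<and> E = F"
      using x(3) g x(4) unfolding restrictions_iff[OF assms(1)]
      by (intro normal_form_unique[OF assms(1) g(1-4) _ _ _ x(2)]) auto
    then show "x = (length as, W, as, E)" using x by simp
  qed
qed

end
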